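(* The following decision problem can be solved in time $O(|X|\,|T|^2)$: given a decision tree $T$ over a finite feature set $X$ (with any finite number of classes, and with categorical and numerical features), an entity $e$ over $X$ and a feature $x\in X$, decide whether $x$ is relevant for the prediction $T(e)$.
   Context: Features and entities. $X$ is a finite set of features, partitioned as $X=X_C\cup X_N$ into categorical and numerical features. Each $x\in X_C$ has a finite domain $\mathcal{D}_x$; each $x\in X_N$ has domain $\mathcal{D}_x=[m_x,M_x]$ with $m_x\in\mathbb{R}\cup\{-\infty\}$, $M_x\in\mathbb{R}\cup\{\infty\}$. An entity over $X$ is a function $e$ assigning to each $x\in X$ a value $e(x)\in\mathcal{D}_x$. A $k$-class model over $X$ is a map $M$ from the set of entities to $\{0,\dots,k-1\}$. Sufficient reasons. A set $S\subseteq X$ is a reason for $M(e)$ if $M(e')=M(e)$ for every entity $e'$ with $e'(x)=e(x)$ for all $x\in S$. A sufficient reason for $M(e)$ is a reason that is minimal under inclusion; $SR(M,e)$ is the set of sufficient reasons. A feature $x$ is relevant for $M(e)$ if $x\in S$ for some $S\in SR(M,e)$. Decision trees. A $k$-class decision tree over $X$ is a binary tree $T$ in which every internal node has an ordered pair of children (left, right) and is labeled either by a pair $(x,D)$ with $x\in X_C$, $D\subseteq\mathcal{D}_x$, or by a pair $(x,b)$ with $x\in X_N$, $b\in\mathcal{D}_x$; leaves are labeled with classes in $\{0,\dots,k-1\}$. The literal of a node is $x\in D$, respectively $x\le b$. The prediction $T(e)$ is the label of the leaf reached from the root by moving to the left child if the literal of the current node is satisfied by $e$ (i.e. $e(x)\in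 D$, respectively $e(x)\le b$), and to the right child otherwise. The size $|T|$ is the number of nodes of $T$. It is assumed without loss of generality that no label is of the form $(x,\emptyset)$, $(x,\mathcal{D}_x)$ (categorical) or $(x,M_x)$ (numerical). *)

theory Defs
  imports "HOL-Library.FuncSet" "HOL-Library.Extended_Real"
begin

section \<open>Features, entities and sufficient reasons\<close>

text \<open>The constructor of \<open>D x\<close> determines whether the feature \<open>x\<close> belongs to
  \<open>X\<^sub>C\<close> or to \<open>X\<^sub>N\<close>.  Values of numerical features are real numbers; only the bounds of a
  numerical domain may be infinite.\<close>

datatype 'c feature_domain = Categorical "'c set" | Numerical ereal ereal

datatype 'c feature_value = CatVal 'c | NumVal real

fun domain_values :: "'c feature_domain \<Rightarrow> 'c feature_value set" where
  "domain_values (Categorical A) = CatVal ` A"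
| "domain_values (Numerical m M) = NumVal ` {v. m \<le> ereal v \<and> ereal v \<le> M}"

fun valid_domain :: "'c feature_domain \<Rightarrow> bool" where
  "valid_domain (Categorical A) \<longleftrightarrow> finite A"
| "valid_domain (Numerical m M) \<longleftrightarrow> m \<noteq> \<infinity> \<and> M \<noteq> -\<infinity>"

definition feature_space :: "'f set \<Rightarrow> ('f \<Rightarrow> 'c feature_domain) \<Rightarrow> bool" where
  "feature_space X D \<longleftrightarrow> finite X \<and> (\<forall>x\<in>X. valid_domain (D x))"

type_synonym ('f, 'c) entity = "'f \<Rightarrow> 'c feature_value"

definition entities :: "'f set \<Rightarrow> ('f \<Rightarrow> 'c feature_domain) \<Rightarrow> ('f, 'c) entity set" where
  "entities X D = (\<Pi>\<^sub>E x\<in>X. domain_values (D x))"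

definition is_reason ::
  "'f set \<Rightarrow> ('f \<Rightarrow> 'c feature_domain) \<Rightarrow> (('f, 'c) entity \<Rightarrow> nat) \<Rightarrow> ('f, 'c) entity \<Rightarrow> 'f set \<Rightarrow> bool"
  where
  "is_reason X D M e S \<longleftrightarrow>
     S \<subseteq> X \<and> (\<forall>e'\<in>entities X D. (\<forall>x\<in>S. e' x = e x) \<longrightarrow> M e' = M e)"

definition sufficient_reasons ::
  "'f set \<Rightarrow> ('f \<Rightarrow> 'c feature_domain) \<Rightarrow> (('f, 'c) entity \<Rightarrow> nat) \<Rightarrow> ('f, 'c) entity \<Rightarrow> 'f set set"
  where
  "sufficient_reasons X D M e =
     {S. is_reason X D M e S \<and> (\<forall>S'. S' \<subset> S \<longrightarrow> \<not> is_reason X D M e S')}"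

definition relevant ::
  "'f set \<Rightarrow> ('f \<Rightarrow> 'c feature_domain) \<Rightarrow> (('f, 'c) entity \<Rightarrow> nat) \<Rightarrow> ('f, 'c) entity \<Rightarrow> 'f \<Rightarrow> bool"
  where
  "relevant X D M e x \<longleftrightarrow> (\<exists>S\<in>sufficient_reasons X D M e. x \<in> S)"

section \<open>Decision trees\<close>

datatype ('f, 'c) dtree =
    Leaf nat
  | CatNode 'f "'c set" "('f, 'c) dtree" "('f, 'c) dtree"
  | NumNode 'f real "('f, 'c) dtree" "('f, 'c) dtree"

fun decision_tree :: "'f set \<Rightarrow> ('f \<Rightarrow> 'c feature_domain) \<Rightarrow> nat \<Rightarrow> ('f, 'c) dtree \<Rightarrow> bool" where
  "decision_tree X D k (Leaf c) \<longleftrightarrow> c < k"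
| "decision_tree X D k (CatNode x B l r) \<longleftrightarrow>
     x \<in> X \<and> (\<exists>A. D x = Categorical A \<and> B \<subseteq> A \<and> B \<noteq> {} \<and> B \<noteq> A) \<and>
     decision_tree X D k l \<and> decision_tree X D k r"
| "decision_tree X D k (NumNode x b l r) \<longleftrightarrow>
     x \<in> X \<and> (\<exists>m M. D x = Numerical m M \<and> m \<le> ereal b \<and> ereal b \<le> M \<and> ereal b \<noteq> M) \<and>
     decision_tree X D k l \<and> decision_tree X D k r"

fun predict :: "('f, 'c) dtree \<Rightarrow> ('f, 'c) entity \<Rightarrow> nat" where
  "predict (Leaf c) e = c"
| "predict (CatNode x B l r) e = (if e x \<in> CatVal ` B then predict l e else predict r e)"
| "predict (NumNode x b l r) e = (if e x \<in> NumVal ` {..b} then predict l e else predict r e)"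

fun num_nodes :: "('f, 'c) dtree \<Rightarrow> nat" where
  "num_nodes (Leaf c) = 1"
| "num_nodes (CatNode x B l r) = 1 + num_nodes l + num_nodes r"
| "num_nodes (NumNode x b l r) = 1 + num_nodes l + num_nodes r"

lemma num_nodes_pos: "0 < num_nodes T"
  by (cases T) auto

lemma predict_less: "decision_tree X D k T \<Longrightarrow> predict T e < k"
  by (induction T) auto

section \<open>The machine model\<close>

text \<open>
  A random access machine with unit costs, programmed by structured commands.  It has natural
  number registers and, as in the real RAM, typed arrays: arrays of natural numbers, of feature
  values, and of sets of categorical values.  On natural numbers there are addition and truncated
  subtraction but no multiplication, which excludes the well-known abuse of unit costs.  Feature
  values are opaque: they can be moved, compared if numerical, and tested for membership in a set
  if categorical.  Sets can be moved, intersected, subtracted and tested for emptiness.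

  Operations on a set of categorical values take one step whatever the size of the set: the size
  of a tree is its number of nodes, hence a set labelling a node counts as an atomic datum.

  Every elementary command and every test takes one step.  A program is a fixed finite object, so
  the sizes of the expressions in it only affect the constant factor.
\<close>

type_synonym name = string

datatype nexp =
    Const nat
  | Var name
  | Elem name nexp
  | Plus nexp nexp
  | Minus nexp nexp

datatype test =
    Less nexp nexp
  | Equal nexp nexp
  | Neg test
  | Conj test test
  | ValLe name nexp name nexp
  | ValIn name nexp name nexp
  | SetEmpty name nexp

datatype com =
    Skip
  | Assign name nexp
  | NatStore name nexp nexp
  | ValMove name nexp name nexp
  | SetMove name nexp name nexp
  | SetInter name nexp name nexp
  | SetDiff name nexp name nexp
  | Seq com com
  | Cond test com com
  | While test com

record 'c state =
  reg :: "name \<Rightarrow> nat"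
  nat_arrays :: "name \<Rightarrow> nat \<Rightarrow> nat"
  val_arrays :: "name \<Rightarrow> nat \<Rightarrow> 'c feature_value"
  set_arrays :: "name \<Rightarrow> nat \<Rightarrow> 'c set"

fun nval :: "nexp \<Rightarrow> 'c state \<Rightarrow> nat" where
  "nval (Const n) s = n"
| "nval (Var v) s = reg s v"
| "nval (Elem a i) s = nat_arrays s a (nval i s)"
| "nval (Plus i j) s = nval i s + nval j s"
| "nval (Minus i j) s = nval i s - nval j s"

fun val_le :: "'c feature_value \<Rightarrow> 'c feature_value \<Rightarrow> bool" where
  "val_le (NumVal u) (NumVal v) \<longleftrightarrow> u \<le> v"
| "val_le _ _ \<longleftrightarrow> False"

fun tval :: "test \<Rightarrow> 'c state \<Rightarrow> bool" where
  "tval (Less i j) s \<longleftrightarrow> nval i s < nval j s"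
| "tval (Equal i j) s \<longleftrightarrow> nval i s = nval j s"
| "tval (Neg b) s \<longleftrightarrow> \<not> tval b s"
| "tval (Conj b c) s \<longleftrightarrow> tval b s \<and> tval c s"
| "tval (ValLe a i b j) s \<longleftrightarrow> val_le (val_arrays s a (nval i s)) (val_arrays s b (nval j s))"
| "tval (ValIn a i b j) s \<longleftrightarrow> val_arrays s a (nval i s) \<in> CatVal ` set_arrays s b (nval j s)"
| "tval (SetEmpty a i) s \<longleftrightarrow> set_arrays s a (nval i s) = {}"

definition store :: "(name \<Rightarrow> nat \<Rightarrow> 'v) \<Rightarrow> name \<Rightarrow> nat \<Rightarrow> 'v \<Rightarrow> name \<Rightarrow> nat \<Rightarrow> 'v" where
  "store m a i v = m(a := (m a)(i := v))"

text \<open>\<open>exec p s t s'\<close>: started in \<open>s\<close>, the program \<open>p\<close> halts after exactly \<open>t\<close> steps in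
  \<open>s'\<close>.\<close>

inductive exec :: "com \<Rightarrow> 'c state \<Rightarrow> nat \<Rightarrow> 'c state \<Rightarrow> bool" where
  Skip: "exec Skip s 1 s"
| Assign: "exec (Assign v i) s 1 (s\<lparr>reg := (reg s)(v := nval i s)\<rparr>)"
| NatStore: "exec (NatStore a i j) s 1 (s\<lparr>nat_arrays := store (nat_arrays s) a (nval i s) (nval j s)\<rparr>)"
| ValMove: "exec (ValMove a i b j) s 1
    (s\<lparr>val_arrays := store (val_arrays s) a (nval i s) (val_arrays s b (nval j s))\<rparr>)"
| SetMove: "exec (SetMove a i b j) s 1
    (s\<lparr>set_arrays := store (set_arrays s) a (nval i s) (set_arrays s b (nval j s))\<rparr>)"
| SetInter: "exec (SetInter a i b j) s 1
    (s\<lparr>set_arrays := store (set_arrays s) a (nval i s) (set_arrays s a (nval i s) \<inter> set_arrays s b (nval j s))\<rparr>)"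
| SetDiff: "exec (SetDiff a i b j) s 1
    (s\<lparr>set_arrays := store (set_arrays s) a (nval i s) (set_arrays s a (nval i s) - set_arrays s b (nval j s))\<rparr>)"
| Seq: "exec p s t s' \<Longrightarrow> exec q s' u s'' \<Longrightarrow> exec (Seq p q) s (t + u) s''"
| CondTrue: "tval b s \<Longrightarrow> exec p s t s' \<Longrightarrow> exec (Cond b p q) s (1 + t) s'"
| CondFalse: "\<not> tval b s \<Longrightarrow> exec q s t s' \<Longrightarrow> exec (Cond b p q) s (1 + t) s'"
| WhileFalse: "\<not> tval b s \<Longrightarrow> exec (While b p) s 1 s"
| WhileTrue: "tval b s \<Longrightarrow> exec p s t s' \<Longrightarrow> exec (While b p) s' u s'' \<Longrightarrow>
    exec (While b p) s (1 + t + u) s''"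

inductive_cases exec_elims:
  "exec Skip s t s'" "exec (Assign v i) s t s'" "exec (NatStore a i j) s t s'"
  "exec (ValMove a i b j) s t s'" "exec (SetMove a i b j) s t s'" "exec (SetInter a i b j) s t s'"
  "exec (SetDiff a i b j) s t s'" "exec (Seq p q) s t s'" "exec (Cond b p q) s t s'"

inductive_cases exec_WhileE: "exec (While b p) s t s'"

lemma exec_deterministic:
  "exec p s t s' \<Longrightarrow> exec p s u s'' \<Longrightarrow> u = t \<and> s'' = s'"
proof (induction arbitrary: u s'' rule: exec.induct)
  case (Seq p s t s1 q u1 s2)
  from Seq.prems show ?case
    by (rule exec_elims) (use Seq.IH in fastforce)
next
  case (CondTrue b s p t s1 q)
  from CondTrue.prems show ?case
    by (rule exec_elims) (use CondTrue.IH CondTrue.hyps in fastforce)+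
next
  case (CondFalse b s q t s1 p)
  from CondFalse.prems show ?case
    by (rule exec_elims) (use CondFalse.IH CondFalse.hyps in fastforce)+
next
  case (WhileFalse b s p)
  from WhileFalse.prems show ?case
    by (rule exec_WhileE) (use WhileFalse.hyps in simp_all)
next
  case (WhileTrue b s p t s1 u1 s2)
  from WhileTrue.prems show ?case
    by (rule exec_WhileE) (use WhileTrue.IH WhileTrue.hyps in fastforce)+
qed (erule exec_elims, simp)+

section \<open>Presenting an instance to the machine\<close>

text \<open>
  A list \<open>fs\<close> enumerating the feature set names the features by the indices below
  \<^term>\<open>length fs\<close>.  The nodes of the tree are numbered in preorder and stored as records
  with pointers to the children; node 0 is the root.  Cells that hold no input are \<open>0\<close>,
  \<open>undefined\<close> or empty.
\<close>

definition index_of :: "'f list \<Rightarrow> 'f \<Rightarrow> nat" where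
  "index_of fs x = (THE i. i < length fs \<and> fs ! i = x)"

definition array :: "nat \<Rightarrow> 'v \<Rightarrow> (nat \<Rightarrow> 'v) \<Rightarrow> nat \<Rightarrow> 'v" where
  "array n d f i = (if i < n then f i else d)"

fun preorder :: "('f, 'c) dtree \<Rightarrow> ('f, 'c) dtree list" where
  "preorder (Leaf c) = [Leaf c]"
| "preorder (CatNode x B l r) = CatNode x B l r # preorder l @ preorder r"
| "preorder (NumNode x b l r) = NumNode x b l r # preorder l @ preorder r"

lemma length_preorder: "length (preorder T) = num_nodes T"
  by (induction T) auto

fun node_kind :: "('f, 'c) dtree \<Rightarrow> nat" where
  "node_kind (Leaf c) = 0"
| "node_kind (CatNode x B l r) = 1"
| "node_kind (NumNode x b l r) = 2"

fun node_class :: "('f, 'c) dtree \<Rightarrow> nat" where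
  "node_class (Leaf c) = c"
| "node_class _ = 0"

fun node_feature :: "'f list \<Rightarrow> ('f, 'c) dtree \<Rightarrow> nat" where
  "node_feature fs (Leaf c) = 0"
| "node_feature fs (CatNode x B l r) = index_of fs x"
| "node_feature fs (NumNode x b l r) = index_of fs x"

fun node_set :: "('f, 'c) dtree \<Rightarrow> 'c set" where
  "node_set (CatNode x B l r) = B"
| "node_set _ = {}"

fun node_threshold :: "('f, 'c) dtree \<Rightarrow> 'c feature_value" where
  "node_threshold (NumNode x b l r) = NumVal b"
| "node_threshold _ = undefined"

fun left_child :: "nat \<Rightarrow> ('f, 'c) dtree \<Rightarrow> nat" where
  "left_child i (Leaf c) = 0"
| "left_child i (CatNode x B l r) = i + 1"
| "left_child i (NumNode x b l r) = i + 1"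

fun right_child :: "nat \<Rightarrow> ('f, 'c) dtree \<Rightarrow> nat" where
  "right_child i (Leaf c) = 0"
| "right_child i (CatNode x B l r) = i + 1 + num_nodes l"
| "right_child i (NumNode x b l r) = i + 1 + num_nodes l"

fun domain_kind :: "'c feature_domain \<Rightarrow> nat" where
  "domain_kind (Categorical A) = 1"
| "domain_kind (Numerical m M) = 2"

fun domain_set :: "'c feature_domain \<Rightarrow> 'c set" where
  "domain_set (Categorical A) = A"
| "domain_set (Numerical m M) = {}"

fun lower_bounded :: "'c feature_domain \<Rightarrow> nat" where
  "lower_bounded (Numerical m M) = (if m = -\<infinity> then 0 else 1)"
| "lower_bounded (Categorical A) = 0"

fun upper_bounded :: "'c feature_domain \<Rightarrow> nat" where
  "upper_bounded (Numerical m M) = (if M = \<infinity> then 0 else 1)"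
| "upper_bounded (Categorical A) = 0"

fun lower_bound :: "'c feature_domain \<Rightarrow> 'c feature_value" where
  "lower_bound (Numerical m M) = (if m = -\<infinity> then undefined else NumVal (real_of_ereal m))"
| "lower_bound (Categorical A) = undefined"

fun upper_bound :: "'c feature_domain \<Rightarrow> 'c feature_value" where
  "upper_bound (Numerical m M) = (if M = \<infinity> then undefined else NumVal (real_of_ereal M))"
| "upper_bound (Categorical A) = undefined"

definition input_state ::
  "'f list \<Rightarrow> ('f \<Rightarrow> 'c feature_domain) \<Rightarrow> nat \<Rightarrow> ('f, 'c) dtree \<Rightarrow> ('f, 'c) entity \<Rightarrow> 'f \<Rightarrow> 'c state"
  where
  "input_state fs D k T e x =
    (let n = length fs; N = num_nodes T; node = (\<lambda>i. preorder T ! i) in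
     \<lparr>reg = (\<lambda>_. 0)
        (''features'' := n, ''classes'' := k, ''nodes'' := N, ''query'' := index_of fs x),
      nat_arrays = (\<lambda>_ _. 0)
        (''domain_kind'' := array n 0 (\<lambda>i. domain_kind (D (fs ! i))),
         ''lower_bounded'' := array n 0 (\<lambda>i. lower_bounded (D (fs ! i))),
         ''upper_bounded'' := array n 0 (\<lambda>i. upper_bounded (D (fs ! i))),
         ''kind'' := array N 0 (\<lambda>i. node_kind (node i)),
         ''class'' := array N 0 (\<lambda>i. node_class (node i)),
         ''feature'' := array N 0 (\<lambda>i. node_feature fs (node i)),
         ''left'' := array N 0 (\<lambda>i. left_child i (node i)),
         ''right'' := array N 0 (\<lambda>i. right_child i (node i))),
      val_arrays = (\<lambda>_ _. undefined)
        (''entity'' := array n undefined (\<lambda>i. e (fs ! i)),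
         ''lower_bound'' := array n undefined (\<lambda>i. lower_bound (D (fs ! i))),
         ''upper_bound'' := array n undefined (\<lambda>i. upper_bound (D (fs ! i))),
         ''threshold'' := array N undefined (\<lambda>i. node_threshold (node i))),
      set_arrays = (\<lambda>_ _. {})
        (''domain'' := array n {} (\<lambda>i. domain_set (D (fs ! i))),
         ''set'' := array N {} (\<lambda>i. node_set (node i)))\<rparr>)"

end

theory Submission
  imports Defs
begin

text \<open>
  For a leaf \<open>v\<close>, call a feature \<open>y\<close> conflicting if \<open>e y\<close> violates the conditions on \<open>y\<close> along the branch
  to \<open>v\<close>.  A set of features is a reason iff it meets the conflict set of every adverse leaf, i.e. of
  every leaf of another class that some entity reaches.  So sufficient reasons are the minimal
  hitting sets of these conflict sets, and \<open>x\<close> lies in one of them iff it lies in the conflict set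
  \<open>C\<close> of some adverse leaf such that \<open>C - {x}\<close> contains no conflict set of an adverse leaf.  A table of
  all conflict sets takes time \<open>O(|T| (|X| + |T|))\<close>, and comparing all pairs of rows
  \<open>O(|X| |T|\<^sup>2)\<close>.
\<close>

section \<open>Branches of a decision tree\<close>

text \<open>Each literal restricts one feature and the entities form a product, so reachability of a
  leaf and its conflict set can both be read off feature by feature, from one description of the
  admissible values. Leaves that no entity reaches must be discarded, since they would impose
  spurious hitting conditions. The set of admissible values is therefore stored in a form that
  allows emptiness to be tested in constant time. The machine neither multiplies nor recurses. Row
  offsets are advanced by addition, and every node is reached by a fresh walk from the root, steered
  by preorder numbers. Such a walk takes O(|T|) steps, which is affordable: |T| (|X| + |T|) is at
  most 2 |X| |T|^2, because X contains x and so is nonempty. The prediction T(e) needs no separate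
  evaluation: it is the class of the leaf whose conflict set is empty.\<close>

fun split_feature :: "('f, 'c) dtree \<Rightarrow> 'f" where
  "split_feature (Leaf c) = undefined"
| "split_feature (CatNode x B l r) = x"
| "split_feature (NumNode x b l r) = x"

fun literal :: "('f, 'c) dtree \<Rightarrow> 'c feature_value set" where
  "literal (Leaf c) = {}"
| "literal (CatNode x B l r) = CatVal ` B"
| "literal (NumNode x b l r) = NumVal ` {..b}"

text \<open>\<open>branch T v\<close> lists the inner nodes above node \<open>v\<close> (in preorder), each with the truth value
  that its literal takes on the way to \<open>v\<close>.\<close>

fun branch :: "('f, 'c) dtree \<Rightarrow> nat \<Rightarrow> (('f, 'c) dtree \<times> bool) list" where
  "branch (Leaf c) v = []"
| "branch (CatNode x B l r) v =
     (if v = 0 then []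
      else if v \<le> num_nodes l then (CatNode x B l r, True) # branch l (v - 1)
      else (CatNode x B l r, False) # branch r (v - 1 - num_nodes l))"
| "branch (NumNode x b l r) v =
     (if v = 0 then []
      else if v \<le> num_nodes l then (NumNode x b l r, True) # branch l (v - 1)
      else (NumNode x b l r, False) # branch r (v - 1 - num_nodes l))"

definition follows :: "('f, 'c) entity \<Rightarrow> (('f, 'c) dtree \<times> bool) list \<Rightarrow> bool" where
  "follows e ls \<longleftrightarrow> (\<forall>(t, d)\<in>set ls. e (split_feature t) \<in> literal t \<longleftrightarrow> d)"

lemma follows_simps [simp]:
  "follows e []"
  "follows e ((t, d) # ls) \<longleftrightarrow> (e (split_feature t) \<in> literal t \<longleftrightarrow> d) \<and> follows e ls"
  by (auto simp: follows_def)

text \<open>Splits the index by the same three cases as \<open>branch\<close>, so that inductions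
  unfold both together. The simp calls that use it switch \<open>preorder.simps\<close> off.\<close>

lemma preorder_nth:
  "preorder (CatNode x B l r) ! v =
     (if v = 0 then CatNode x B l r
      else if v \<le> num_nodes l then preorder l ! (v - 1) else preorder r ! (v - 1 - num_nodes l))"
  "preorder (NumNode x b l r) ! v =
     (if v = 0 then NumNode x b l r
      else if v \<le> num_nodes l then preorder l ! (v - 1) else preorder r ! (v - 1 - num_nodes l))"
  by (auto simp: nth_Cons' nth_append length_preorder)

lemma predict_of_branch:
  assumes "v < num_nodes T" "preorder T ! v = Leaf c" "follows e (branch T v)"
  shows "predict T e = c"
  using assms
proof (induction T arbitrary: v)
  case (CatNode x B l r)
  have "0 < v" using CatNode.prems by (cases v) auto
  show ?case
  proof (cases "v \<le> num_nodes l")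
    case True
    with \<open>0 < v\<close> CatNode.prems have "predict l e = c" "e x \<in> CatVal ` B"
      by (intro CatNode.IH(1)[of "v - 1"], simp_all add: preorder_nth del: preorder.simps)
    then show ?thesis by simp
  next
    case False
    with \<open>0 < v\<close> CatNode.prems have "predict r e = c" "e x \<notin> CatVal ` B"
      by (intro CatNode.IH(2)[of "v - 1 - num_nodes l"], simp_all add: preorder_nth del: preorder.simps)
    then show ?thesis by simp
  qed
next
  case (NumNode x b l r)
  have "0 < v" using NumNode.prems by (cases v) auto
  show ?case
  proof (cases "v \<le> num_nodes l")
    case True
    with \<open>0 < v\<close> NumNode.prems have "predict l e = c" "e x \<in> NumVal ` {..b}"
      by (intro NumNode.IH(1)[of "v - 1"], simp_all add: preorder_nth del: preorder.simps)
    then show ?thesis by simp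
  next
    case False
    with \<open>0 < v\<close> NumNode.prems have "predict r e = c" "e x \<notin> NumVal ` {..b}"
      by (intro NumNode.IH(2)[of "v - 1 - num_nodes l"], simp_all add: preorder_nth del: preorder.simps)
    then show ?thesis by simp
  qed
qed auto

lemma ex_branch_predict:
  "\<exists>v<num_nodes T. preorder T ! v = Leaf (predict T e) \<and> follows e (branch T v)"
proof (induction T)
  case (CatNode x B l r)
  then obtain v w where v: "v < num_nodes l" "preorder l ! v = Leaf (predict l e)" "follows e (branch l v)"
    and w: "w < num_nodes r" "preorder r ! w = Leaf (predict r e)" "follows e (branch r w)" by blast
  show ?case
  proof (cases "e x \<in> CatVal ` B")
    case True
    with v show ?thesis
      by (intro exI[of _ "Suc v"]) (simp add: preorder_nth del: preorder.simps)
  next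
    case False
    with w show ?thesis
      by (intro exI[of _ "Suc (num_nodes l + w)"]) (simp add: preorder_nth del: preorder.simps)
  qed
next
  case (NumNode x b l r)
  then obtain v w where v: "v < num_nodes l" "preorder l ! v = Leaf (predict l e)" "follows e (branch l v)"
    and w: "w < num_nodes r" "preorder r ! w = Leaf (predict r e)" "follows e (branch r w)" by blast
  show ?case
  proof (cases "e x \<in> NumVal ` {..b}")
    case True
    with v show ?thesis
      by (intro exI[of _ "Suc v"]) (simp add: preorder_nth del: preorder.simps)
  next
    case False
    with w show ?thesis
      by (intro exI[of _ "Suc (num_nodes l + w)"]) (simp add: preorder_nth del: preorder.simps)
  qed
qed simp

lemma branch_decision_tree:
  assumes "decision_tree X D k T" "(t, d) \<in> set (branch T v)"
  shows "decision_tree X D k t \<and> node_kind t \<noteq> 0"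
  using assms by (induction T arbitrary: v) (auto split: if_splits)

lemma split_feature_mem: "decision_tree X D k t \<Longrightarrow> node_kind t \<noteq> 0 \<Longrightarrow> split_feature t \<in> X"
  by (cases t) auto

lemma leaf_iff: "node_kind t = 0 \<longleftrightarrow> t = Leaf (node_class t)"
  by (cases t) auto

text \<open>The entities that follow a branch form a box; this is its side in direction
  \<open>y\<close>.\<close>

definition allowed ::
  "('f \<Rightarrow> 'c feature_domain) \<Rightarrow> (('f, 'c) dtree \<times> bool) list \<Rightarrow> 'f \<Rightarrow> 'c feature_value set" where
  "allowed D ls y =
     {w \<in> domain_values (D y). \<forall>(t, d)\<in>set ls. split_feature t = y \<longrightarrow> (w \<in> literal t \<longleftrightarrow> d)}"

lemma allowed_Nil [simp]: "allowed D [] y = domain_values (D y)"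
  by (simp add: allowed_def)

text \<open>A walk from the root meets new conditions at the end of the list. The cases are the
  updates that \<open>descend\<close> makes to a cell.\<close>

lemma allowed_snoc:
  "allowed D (ls @ [(t, d)]) y =
     (if split_feature t \<noteq> y then allowed D ls y
      else if d then allowed D ls y \<inter> literal t else allowed D ls y - literal t)"
  by (auto simp: allowed_def)

section \<open>Sufficient reasons as minimal hitting sets\<close>

lemma is_reason_mono:
  "is_reason X D M e S \<Longrightarrow> S \<subseteq> S' \<Longrightarrow> S' \<subseteq> X \<Longrightarrow> is_reason X D M e S'"
  unfolding is_reason_def by blast

text \<open>Reasons are closed under supersets. A minimal reason inside \<open>S\<close> must
  therefore contain \<open>x\<close>, since otherwise \<open>S - {x}\<close> would inherit being a
  reason from it.\<close>

lemma relevant_iff: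
  assumes "finite X"
  shows "relevant X D M e x \<longleftrightarrow> (\<exists>S. is_reason X D M e S \<and> \<not> is_reason X D M e (S - {x}))"
proof
  assume "relevant X D M e x"
  then obtain S where "S \<in> sufficient_reasons X D M e" "x \<in> S"
    by (auto simp: relevant_def)
  then have "is_reason X D M e S" "\<not> is_reason X D M e (S - {x})"
    by (auto simp: sufficient_reasons_def)
  then show "\<exists>S. is_reason X D M e S \<and> \<not> is_reason X D M e (S - {x})" by blast
next
  assume "\<exists>S. is_reason X D M e S \<and> \<not> is_reason X D M e (S - {x})"
  then obtain S where S: "is_reason X D M e S" "\<not> is_reason X D M e (S - {x})" by blast
  then have "S \<subseteq> X" by (simp add: is_reason_def)
  then have "finite {R. R \<subseteq> S \<and> is_reason X D M e R}"
    using assms by (auto intro: rev_finite_subset[of "Pow X"])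
  then obtain R where R: "R \<subseteq> S" "is_reason X D M e R"
    and min: "\<And>R'. R' \<subseteq> S \<Longrightarrow> is_reason X D M e R' \<Longrightarrow> R' \<subseteq> R \<Longrightarrow> R = R'"
    using finite_has_minimal[of "{R. R \<subseteq> S \<and> is_reason X D M e R}"] S(1)
    by (metis (mono_tags, lifting) empty_iff mem_Collect_eq order_refl)
  have "x \<in> R"
  proof (rule ccontr)
    assume "x \<notin> R"
    then have "R \<subseteq> S - {x}" using R(1) by blast
    then show False using is_reason_mono[OF R(2)] S(2) \<open>S \<subseteq> X\<close> by blast
  qed
  moreover have "R \<in> sufficient_reasons X D M e"
    unfolding sufficient_reasons_def using R(2) min R(1) by blast
  ultimately show "relevant X D M e x" by (auto simp: relevant_def)
qed

section \<open>Hitting conditions of a decision tree\<close>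

locale tree_instance =
  fixes X :: "'f set" and D :: "'f \<Rightarrow> 'c feature_domain" and k :: nat
    and T :: "('f, 'c) dtree" and e :: "('f, 'c) entity" and x :: 'f
  assumes space: "feature_space X D" and tree: "decision_tree X D k T"
    and entity: "e \<in> entities X D" and x_mem: "x \<in> X"
begin

text \<open>The value of \<open>e\<close> always lies in the domain, so leaving
  \<open>allowed\<close> means violating a literal. Using \<open>allowed\<close> lets one cell
  answer both this question and the emptiness question.\<close>

definition conflict :: "nat \<Rightarrow> 'f \<Rightarrow> bool" where
  "conflict v y \<longleftrightarrow> e y \<notin> allowed D (branch T v) y"

text \<open>A product is nonempty as soon as all its sides are, so this is reachability by some
  entity.\<close>

definition live_leaf :: "nat \<Rightarrow> bool" where
  "live_leaf v \<longleftrightarrow> node_kind (preorder T ! v) = 0 \<and> (\<forall>y\<in>X. allowed D (branch T v) y \<noteq> {})"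

definition adverse :: "nat \<Rightarrow> bool" where
  "adverse v \<longleftrightarrow> v < num_nodes T \<and> live_leaf v \<and> node_class (preorder T ! v) \<noteq> predict T e"

lemma entity_value: "y \<in> X \<Longrightarrow> e y \<in> domain_values (D y)"
  using entity by (auto simp: entities_def PiE_iff)

text \<open>All tested features lie in \<open>X\<close>, and an entity satisfies the domain clause
  of \<open>allowed\<close> anyway; what remains is to regroup the literals by feature.\<close>

lemma follows_iff_allowed:
  assumes "e' \<in> entities X D"
  shows "follows e' (branch T v) \<longleftrightarrow> (\<forall>y\<in>X. e' y \<in> allowed D (branch T v) y)"
  using assms branch_decision_tree[OF tree] split_feature_mem
  by (fastforce simp: follows_def allowed_def entities_def PiE_iff)

text \<open>An entity that agrees with \<open>e\<close> on \<open>S\<close> can reach a live leaf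
  exactly if no feature of \<open>S\<close> conflicts there; \<open>S\<close> fails to be a reason
  exactly if this happens at a leaf of another class.\<close>

lemma is_reason_iff_hits:
  "is_reason X D (predict T) e S \<longleftrightarrow> S \<subseteq> X \<and> (\<forall>v. adverse v \<longrightarrow> (\<exists>y\<in>S. conflict v y))"
proof safe
  assume "is_reason X D (predict T) e S"
  then have S: "S \<subseteq> X"
    and reason: "\<And>e'. e' \<in> entities X D \<Longrightarrow> \<forall>y\<in>S. e' y = e y \<Longrightarrow> predict T e' = predict T e"
    by (auto simp: is_reason_def)
  show "y \<in> X" if "y \<in> S" for y using S that by blast
  fix v assume v: "adverse v"
  show "\<exists>y\<in>S. conflict v y"
  proof (rule ccontr)
    assume nc: "\<not> (\<exists>y\<in>S. conflict v y)"
    let ?W = "allowed D (branch T v)"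
    \<comment> \<open>Keep the value of \<open>e\<close> wherever the branch admits it and take any
      admissible value elsewhere. No conflict lies in \<open>S\<close>, so nothing changes on
      \<open>S\<close>; \<open>restrict\<close> provides the extensionality required of
      entities.\<close>
    define e' where "e' = restrict (\<lambda>y. if e y \<in> ?W y then e y else SOME w. w \<in> ?W y) X"
    have mem: "e' y \<in> ?W y" if "y \<in> X" for y
      using v that by (auto simp: e'_def adverse_def live_leaf_def some_in_eq)
    then have e': "e' \<in> entities X D"
      by (auto simp: entities_def allowed_def e'_def)
    then have "follows e' (branch T v)"
      using mem follows_iff_allowed by blast
    then have "predict T e' = node_class (preorder T ! v)"
      using v leaf_iff by (intro predict_of_branch[of v]) (auto simp: adverse_def live_leaf_def)
    moreover have "predict T e' = predict T e"
      using nc S by (intro reason e') (auto simp: e'_def conflict_def)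
    ultimately show False using v by (simp add: adverse_def)
  qed
next
  assume S: "S \<subseteq> X" and hits: "\<forall>v. adverse v \<longrightarrow> (\<exists>y\<in>S. conflict v y)"
  have "predict T e' = predict T e" if e': "e' \<in> entities X D" and eq: "\<forall>y\<in>S. e' y = e y" for e'
  proof (rule ccontr)
    assume neq: "predict T e' \<noteq> predict T e"
    obtain v where v: "v < num_nodes T" "preorder T ! v = Leaf (predict T e')" "follows e' (branch T v)"
      using ex_branch_predict by blast
    then have mem: "\<forall>y\<in>X. e' y \<in> allowed D (branch T v) y"
      using follows_iff_allowed[OF e'] by blast
    with v neq have "adverse v" by (auto simp: adverse_def live_leaf_def)
    with hits obtain y where "y \<in> S" "conflict v y" by blast
    then show False using mem eq S by (metis conflict_def subsetD)
  qed
  then show "is_reason X D (predict T) e S" using S by (auto simp: is_reason_def)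
qed

text \<open>If \<open>C\<close> is the conflict set of \<open>a\<close>, then \<open>X - (C - {x})\<close> is the largest set of features that meets
  \<open>C\<close> at most in \<open>x\<close>.\<close>

lemma relevant_iff_minimal_conflict:
  "relevant X D (predict T) e x \<longleftrightarrow>
     (\<exists>a. adverse a \<and> conflict a x \<and>
        (\<forall>b. adverse b \<longrightarrow> (\<exists>y\<in>X. conflict b y \<and> (\<not> conflict a y \<or> y = x))))"
    (is "_ \<longleftrightarrow> ?R")
proof -
  have "finite X" using space by (simp add: feature_space_def)
  note rel = relevant_iff[OF this] is_reason_iff_hits
  show ?thesis
  proof
    assume "relevant X D (predict T) e x"
    then obtain S where S: "S \<subseteq> X" "\<forall>v. adverse v \<longrightarrow> (\<exists>y\<in>S. conflict v y)"
      and "\<not> (\<forall>v. adverse v \<longrightarrow> (\<exists>y\<in>S - {x}. conflict v y))"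
      unfolding rel by auto
    \<comment> \<open>\<open>S\<close> meets the conflict set of \<open>a\<close> in
      \<open>x\<close> alone. Every other adverse conflict set meets \<open>S\<close> as well, hence
      contains \<open>x\<close> or a feature outside that of \<open>a\<close>.\<close>
    then obtain a where a: "adverse a" "\<forall>y\<in>S - {x}. \<not> conflict a y" by blast
    with S have "conflict a x" by blast
    moreover have "\<exists>y\<in>X. conflict b y \<and> (\<not> conflict a y \<or> y = x)" if "adverse b" for b
      using S a that by blast
    ultimately show ?R using a by blast
  next
    assume ?R
    then obtain a where a: "adverse a" "conflict a x"
      and b: "\<forall>b. adverse b \<longrightarrow> (\<exists>y\<in>X. conflict b y \<and> (\<not> conflict a y \<or> y = x))" by blast
    let ?S = "{y \<in> X. \<not> conflict a y \<or> y = x}"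
    have "is_reason X D (predict T) e ?S" "\<not> is_reason X D (predict T) e (?S - {x})"
      unfolding is_reason_iff_hits using a b by blast+
    then show "relevant X D (predict T) e x"
      unfolding rel(1) by blast
  qed
qed

end

section \<open>Running time and frame conditions of programs\<close>

text \<open>A weakest precondition for total correctness. Time is only bounded from above, so
  branches of different cost need no balancing.\<close>

definition runs :: "com \<Rightarrow> nat \<Rightarrow> ('c state \<Rightarrow> bool) \<Rightarrow> 'c state \<Rightarrow> bool" where
  "runs p b Q s \<longleftrightarrow> (\<exists>t s'. exec p s t s' \<and> t \<le> b \<and> Q s')"

lemma runs_mono: "runs p b Q s \<Longrightarrow> b \<le> b' \<Longrightarrow> (\<And>s'. Q s' \<Longrightarrow> Q' s') \<Longrightarrow> runs p b' Q' s"
  unfolding runs_def by (meson le_trans)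

lemma runs_Seq:
  assumes "runs p b R s" "\<And>s'. R s' \<Longrightarrow> runs q c Q s'" "b + c \<le> d"
  shows "runs (Seq p q) d Q s"
proof -
  obtain t s' where p: "exec p s t s'" "t \<le> b" "R s'" using assms(1) by (auto simp: runs_def)
  then obtain u s'' where "exec q s' u s''" "u \<le> c" "Q s''"
    using assms(2)[OF p(3)] by (auto simp: runs_def)
  with p show ?thesis unfolding runs_def
    using assms(3) by (intro exI[of _ "t + u"] exI[of _ s'']) (auto intro: exec.Seq)
qed

text \<open>The measure \<open>f\<close> drops in every round and so bounds the number of rounds. A
  round costs \<open>c\<close> for the body and one step for the test; the leading 1 pays for the
  final failing test.\<close>

lemma runs_While:
  assumes I: "I s"
    and step: "\<And>s. I s \<Longrightarrow> tval b s \<Longrightarrow> runs p c (\<lambda>s'. I s' \<and> f s' < f s) s"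
  shows "runs (While b p) (1 + f s * (c + 1)) (\<lambda>s'. I s' \<and> \<not> tval b s') s"
  using I
proof (induction "f s" arbitrary: s rule: less_induct)
  case less
  show ?case
  proof (cases "tval b s")
    case True
    then obtain t s' where p: "exec p s t s'" "t \<le> c" "I s'" "f s' < f s"
      using step[OF less.prems True] by (auto simp: runs_def)
    then obtain u s'' where w: "exec (While b p) s' u s''" "u \<le> 1 + f s' * (c + 1)" "I s''" "\<not> tval b s''"
      using less.hyps[OF p(4) p(3)] unfolding runs_def by blast
    have "(f s' + 1) * (c + 1) \<le> f s * (c + 1)"
      using p(4) by (intro mult_right_mono) auto
    then have "1 + t + u \<le> 1 + f s * (c + 1)"
      using p(2) w(2) by (auto simp: algebra_simps)
    then show ?thesis
      unfolding runs_def using exec.WhileTrue[OF True p(1) w(1)] w by blast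
  next
    case False
    then show ?thesis
      unfolding runs_def using less.prems
      by (intro exI[of _ 1] exI[of _ s]) (auto intro: exec.WhileFalse[simplified])
  qed
qed

text \<open>Loop-free code is handled by symbolic evaluation: \<open>cost\<close> and
  \<open>effect\<close> turn a claim about \<open>exec\<close> into a goal for the
  simplifier.\<close>

fun straight :: "com \<Rightarrow> bool" where
  "straight (Seq p q) \<longleftrightarrow> straight p \<and> straight q"
| "straight (Cond b p q) \<longleftrightarrow> straight p \<and> straight q"
| "straight (While b p) \<longleftrightarrow> False"
| "straight _ \<longleftrightarrow> True"

fun cost :: "com \<Rightarrow> nat" where
  "cost (Seq p q) = cost p + cost q"
| "cost (Cond b p q) = 1 + max (cost p) (cost q)"
| "cost _ = 1"

fun effect :: "com \<Rightarrow> 'c state \<Rightarrow> 'c state" where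
  "effect (Assign v i) s = s\<lparr>reg := (reg s)(v := nval i s)\<rparr>"
| "effect (NatStore a i j) s = s\<lparr>nat_arrays := store (nat_arrays s) a (nval i s) (nval j s)\<rparr>"
| "effect (ValMove a i b j) s =
     s\<lparr>val_arrays := store (val_arrays s) a (nval i s) (val_arrays s b (nval j s))\<rparr>"
| "effect (SetMove a i b j) s =
     s\<lparr>set_arrays := store (set_arrays s) a (nval i s) (set_arrays s b (nval j s))\<rparr>"
| "effect (SetInter a i b j) s =
     s\<lparr>set_arrays := store (set_arrays s) a (nval i s)
        (set_arrays s a (nval i s) \<inter> set_arrays s b (nval j s))\<rparr>"
| "effect (SetDiff a i b j) s =
     s\<lparr>set_arrays := store (set_arrays s) a (nval i s)
        (set_arrays s a (nval i s) - set_arrays s b (nval j s))\<rparr>"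
| "effect (Seq p q) s = effect q (effect p s)"
| "effect (Cond b p q) s = (if tval b s then effect p s else effect q s)"
| "effect _ s = s"

lemma exec_straight: "straight p \<Longrightarrow> \<exists>t\<le>cost p. exec p s t (effect p s)"
proof (induction p arbitrary: s)
  case (Seq p q)
  then obtain t u where "t \<le> cost p" "exec p s t (effect p s)"
    "u \<le> cost q" "exec q (effect p s) u (effect q (effect p s))" by (meson straight.simps(1))
  then show ?case by (intro exI[of _ "t + u"]) (auto intro: exec.Seq)
next
  case (Cond b p q)
  show ?case
  proof (cases "tval b s")
    case True
    obtain t where "t \<le> cost p" "exec p s t (effect p s)" using Cond by auto
    with True show ?thesis by (intro exI[of _ "1 + t"]) (auto intro: exec.CondTrue[simplified])
  next
    case False
    obtain t where "t \<le> cost q" "exec q s t (effect q s)" using Cond by auto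
    with False show ?thesis by (intro exI[of _ "1 + t"]) (auto intro: exec.CondFalse[simplified])
  qed
qed (auto intro: exec.intros[simplified])

lemma runs_straight: "straight p \<Longrightarrow> cost p \<le> b \<Longrightarrow> Q (effect p s) \<Longrightarrow> runs p b Q s"
  unfolding runs_def using exec_straight by (meson le_trans)

definition For :: "name \<Rightarrow> name \<Rightarrow> com \<Rightarrow> com" where
  "For i m p = Seq (Assign i (Const 0))
     (While (Less (Var i) (Var m)) (Seq p (Assign i (Plus (Var i) (Const 1)))))"

text \<open>The body leaves the counter alone, so the invariant for \<open>Suc j\<close> is demanded
  of the state in which the counter has been advanced. Each round pays 2 for test and increment; the
  outer 2 pays for the initial assignment and the last test.\<close>

lemma runs_For:
  assumes start: "reg s m = M" "i \<noteq> m" "I 0 (s\<lparr>reg := (reg s)(i := 0)\<rparr>)"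
    and step: "\<And>j s. j < M \<Longrightarrow> reg s i = j \<Longrightarrow> reg s m = M \<Longrightarrow> I j s \<Longrightarrow>
      runs p c (\<lambda>s'. reg s' i = j \<and> reg s' m = M \<and> I (Suc j) (s'\<lparr>reg := (reg s')(i := Suc j)\<rparr>)) s"
    and d: "2 + M * (c + 2) \<le> d"
  shows "runs (For i m p) d (\<lambda>s'. reg s' m = M \<and> I M s') s"
  unfolding For_def
proof (rule runs_Seq)
  let ?J = "\<lambda>s. reg s m = M \<and> reg s i \<le> M \<and> I (reg s i) s"
  show "runs (Assign i (Const 0)) 1 (\<lambda>s'. ?J s' \<and> reg s' i = 0) s"
    by (rule runs_straight) (use start in auto)
  fix s' assume s': "?J s' \<and> reg s' i = 0"
  have "runs (While (Less (Var i) (Var m)) (Seq p (Assign i (Plus (Var i) (Const 1)))))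
      (1 + (M - reg s' i) * (c + 1 + 1)) (\<lambda>s'. ?J s' \<and> \<not> tval (Less (Var i) (Var m)) s') s'"
  proof (rule runs_While)
    fix s assume J: "?J s" and "tval (Less (Var i) (Var m)) s"
    then have lt: "reg s i < M" by simp
    show "runs (Seq p (Assign i (Plus (Var i) (Const 1)))) (c + 1)
        (\<lambda>s'. ?J s' \<and> M - reg s' i < M - reg s i) s"
      by (rule runs_Seq[OF step[OF lt refl _ _]], use J in simp, use J in simp,
          rule runs_straight) (use lt start(2) in auto)
  qed (use s' in auto)
  then show "runs (While (Less (Var i) (Var m)) (Seq p (Assign i (Plus (Var i) (Const 1)))))
      (1 + M * (c + 2)) (\<lambda>s'. reg s' m = M \<and> I M s') s'"
    by (rule runs_mono) (use s' in auto)
qed (use d in simp)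

text \<open>The frame condition of the search phase, which writes registers only. Relating each
  state to the one at entry carries the outer invariants through the nested loops.\<close>

definition keeps :: "name set \<Rightarrow> 'c state \<Rightarrow> 'c state \<Rightarrow> bool" where
  "keeps rs s s' \<longleftrightarrow> (\<forall>r. r \<notin> rs \<longrightarrow> reg s' r = reg s r) \<and> nat_arrays s' = nat_arrays s \<and>
     val_arrays s' = val_arrays s \<and> set_arrays s' = set_arrays s"

lemma keeps_refl [simp]: "keeps rs s s"
  by (simp add: keeps_def)

lemma keeps_trans:
  assumes "keeps rs s s'" "keeps rs' s' s''" "rs \<union> rs' \<subseteq> rs''"
  shows "keeps rs'' s s''"
proof -
  have "r \<notin> rs \<and> r \<notin> rs'" if "r \<notin> rs''" for r using assms(3) that by blast
  then show ?thesis using assms(1,2) by (simp add: keeps_def)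
qed

text \<open>As simp rules these peel off updates of permitted registers one by one, until the bare
  register file remains.\<close>

lemma keeps_update [simp]:
  "r \<in> rs \<Longrightarrow> keeps rs s (s'\<lparr>reg := R(r := i)\<rparr>) = keeps rs s (s'\<lparr>reg := R\<rparr>)"
  "keeps rs s (s'\<lparr>reg := reg s'\<rparr>) = keeps rs s s'"
  by (auto simp: keeps_def)

section \<open>Tracking the values admitted by a branch\<close>

text \<open>A cell \<open>B, hl, l, hu, u\<close> represents a set \<open>W\<close> of values of a feature: by \<open>B\<close> if the feature is
  categorical, and otherwise by the conditions \<open>l < w\<close> (present if \<open>hl = 1\<close>) and \<open>w \<le> u\<close> (present if
  \<open>hu = 1\<close>).  The bounds of the domain are not recorded: thresholds lie in the domain and below its
  maximum, so they do not affect emptiness.\<close>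

fun tracked :: "'c feature_domain \<Rightarrow> 'c feature_value set \<Rightarrow>
    'c set \<Rightarrow> nat \<Rightarrow> 'c feature_value \<Rightarrow> nat \<Rightarrow> 'c feature_value \<Rightarrow> bool" where
  "tracked (Categorical A) W B hl l hu u \<longleftrightarrow> W = CatVal ` B"
| "tracked (Numerical m M) W B hl l hu u \<longleftrightarrow>
     (hl = 1 \<longrightarrow> (\<exists>b. l = NumVal b \<and> m \<le> ereal b \<and> ereal b < M)) \<and>
     (hu = 1 \<longrightarrow> (\<exists>b. u = NumVal b \<and> m \<le> ereal b \<and> ereal b < M)) \<and>
     W = {w \<in> domain_values (Numerical m M). (hl = 1 \<longrightarrow> \<not> val_le w l) \<and> (hu = 1 \<longrightarrow> val_le w u)}"

lemma tracked_start: "tracked d (domain_values d) (domain_set d) 0 l 0 u"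
  by (cases d) auto

lemma tracked_set:
  assumes "tracked (Categorical A) W B hl l hu u"
  shows "tracked (Categorical A) (W \<inter> CatVal ` B') (B \<inter> B') hl l hu u"
    and "tracked (Categorical A) (W - CatVal ` B') (B - B') hl l hu u"
  using assms by auto

text \<open>Of two upper bounds the smaller implies the other. The two cases are those of the
  conditional in \<open>descend\<close>.\<close>

lemma tracked_le:
  assumes "tracked (Numerical m M) W B hl l hu u" "m \<le> ereal b" "ereal b < M"
  shows "hu = 1 \<and> val_le u (NumVal b) \<Longrightarrow> tracked (Numerical m M) (W \<inter> NumVal ` {..b}) B hl l hu u"
    and "\<not> (hu = 1 \<and> val_le u (NumVal b)) \<Longrightarrow>
      tracked (Numerical m M) (W \<inter> NumVal ` {..b}) B hl l 1 (NumVal b)"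
  using assms by auto

lemma tracked_gt:
  assumes "tracked (Numerical m M) W B hl l hu u" "m \<le> ereal b" "ereal b < M"
  shows "hl = 1 \<and> val_le (NumVal b) l \<Longrightarrow> tracked (Numerical m M) (W - NumVal ` {..b}) B hl l hu u"
    and "\<not> (hl = 1 \<and> val_le (NumVal b) l) \<Longrightarrow>
      tracked (Numerical m M) (W - NumVal ` {..b}) B 1 (NumVal b) hu u"
  using assms by auto

lemma tracked_mem_iff:
  assumes "tracked d W B hl l hu u" "w \<in> domain_values d"
  shows "w \<in> W \<longleftrightarrow> (if domain_kind d = 1 then w \<in> CatVal ` B
    else (hl = 1 \<longrightarrow> \<not> val_le w l) \<and> (hu = 1 \<longrightarrow> val_le w u))"
  using assms by (cases d) auto

lemma ex_real_in_ereal_interval: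
  fixes b :: real and M :: ereal
  assumes "ereal b < M"
  shows "\<exists>r. b < r \<and> ereal r \<le> M"
  using assms by (cases M) (auto intro: exI[of _ "b + 1"])

text \<open>Recorded thresholds satisfy \<open>m \<le> b < M\<close>. Thus a lone lower bound leaves
  room above it, a lone upper bound is itself admissible, and with both the set is a half-open
  interval whose upper end lies in the domain. Without bounds the domain itself has to be
  nonempty.\<close>

lemma tracked_empty_iff:
  assumes tr: "tracked d W B hl l hu u" and ne: "domain_values d \<noteq> {}"
  shows "W = {} \<longleftrightarrow> (if domain_kind d = 1 then B = {} else hl = 1 \<and> hu = 1 \<and> val_le u l)"
proof (cases d)
  case (Categorical A)
  with tr show ?thesis by auto
next
  case (Numerical m M)
  note tr = tr[unfolded Numerical tracked.simps]
  have W: "w \<in> W \<longleftrightarrow> w \<in> domain_values d \<and> (hl = 1 \<longrightarrow> \<not> val_le w l) \<and> (hu = 1 \<longrightarrow> val_le w u)" for w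
    using tr by (auto simp: Numerical)
  consider (none) "hl \<noteq> 1" "hu \<noteq> 1" | (lo) b where "hl = 1" "hu \<noteq> 1" "l = NumVal b" "m \<le> ereal b" "ereal b < M"
    | (hi) b where "hu = 1" "hl \<noteq> 1" "u = NumVal b" "m \<le> ereal b" "ereal b < M"
    | (both) a b where "hl = 1" "hu = 1" "l = NumVal a" "u = NumVal b" "m \<le> ereal b" "ereal b < M"
    using tr by metis
  then show ?thesis
  proof cases
    case none
    with W ne show ?thesis by (auto simp: Numerical)
  next
    case lo
    then obtain r where "b < r" "ereal r \<le> M" using ex_real_in_ereal_interval by blast
    moreover from this lo have "m \<le> ereal r" by (meson ereal_less_eq(3) less_imp_le order_trans)
    ultimately have "NumVal r \<in> W" using lo by (auto simp: W Numerical)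
    with lo show ?thesis by (auto simp: Numerical)
  next
    case hi
    then have "NumVal b \<in> W" by (auto simp: W Numerical)
    with hi show ?thesis by (auto simp: Numerical)
  next
    case both
    have "W = {} \<longleftrightarrow> b \<le> a"
    proof
      assume "W = {}"
      then have "NumVal b \<notin> W" by blast
      then show "b \<le> a" using both by (auto simp: W Numerical)
    next
      assume "b \<le> a"
      then show "W = {}" using both W by (fastforce simp: Numerical)
    qed
    with both show ?thesis by (simp add: Numerical)
  qed
qed

section \<open>The program\<close>

notation Seq (infixr ";;" 60)

abbreviation Or :: "test \<Rightarrow> test \<Rightarrow> test" where
  "Or b c \<equiv> Neg (Conj (Neg b) (Neg c))"

abbreviation Is :: "nexp \<Rightarrow> nat \<Rightarrow> test" where
  "Is i c \<equiv> Equal i (Const c)"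

definition reset_cells :: com where
  "reset_cells = For ''y'' ''features''
     (SetMove ''cell'' (Var ''y'') ''domain'' (Var ''y'') ;;
      NatStore ''has_lower'' (Var ''y'') (Const 0) ;;
      NatStore ''has_upper'' (Var ''y'') (Const 0))"

text \<open>The subtree at \<open>u\<close> occupies consecutive preorder numbers from
  \<open>u\<close> on, and its right part starts at the right child. For \<open>v\<close> properly
  below \<open>u\<close>, comparing \<open>v\<close> with that child therefore tells which way leads
  to \<open>v\<close>; neither a stack nor parent pointers are needed.\<close>

definition descend :: com where
  "descend =
     Assign ''y'' (Elem ''feature'' (Var ''u'')) ;;
     Cond (Less (Var ''v'') (Elem ''right'' (Var ''u'')))
       (Cond (Is (Elem ''kind'' (Var ''u'')) 1)
          (SetInter ''cell'' (Var ''y'') ''set'' (Var ''u''))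
          (Cond (Conj (Is (Elem ''has_upper'' (Var ''y'')) 1)
                      (ValLe ''upper'' (Var ''y'') ''threshold'' (Var ''u'')))
             Skip
             (ValMove ''upper'' (Var ''y'') ''threshold'' (Var ''u'') ;;
              NatStore ''has_upper'' (Var ''y'') (Const 1))) ;;
        Assign ''u'' (Elem ''left'' (Var ''u'')))
       (Cond (Is (Elem ''kind'' (Var ''u'')) 1)
          (SetDiff ''cell'' (Var ''y'') ''set'' (Var ''u''))
          (Cond (Conj (Is (Elem ''has_lower'' (Var ''y'')) 1)
                      (ValLe ''threshold'' (Var ''u'') ''lower'' (Var ''y'')))
             Skip
             (ValMove ''lower'' (Var ''y'') ''threshold'' (Var ''u'') ;;
              NatStore ''has_lower'' (Var ''y'') (Const 1))) ;;
        Assign ''u'' (Elem ''right'' (Var ''u'')))"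

definition walk :: com where
  "walk = Assign ''u'' (Const 0) ;; While (Neg (Equal (Var ''u'') (Var ''v''))) descend"

definition cell_empty :: test where
  "cell_empty =
     Or (Conj (Is (Elem ''domain_kind'' (Var ''y'')) 1) (SetEmpty ''cell'' (Var ''y'')))
        (Conj (Neg (Is (Elem ''domain_kind'' (Var ''y'')) 1))
           (Conj (Is (Elem ''has_lower'' (Var ''y'')) 1)
              (Conj (Is (Elem ''has_upper'' (Var ''y'')) 1)
                 (ValLe ''upper'' (Var ''y'') ''lower'' (Var ''y'')))))"

definition cell_excludes :: test where
  "cell_excludes =
     Or (Conj (Is (Elem ''domain_kind'' (Var ''y'')) 1)
              (Neg (ValIn ''entity'' (Var ''y'') ''cell'' (Var ''y''))))
        (Conj (Neg (Is (Elem ''domain_kind'' (Var ''y'')) 1))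
           (Or (Conj (Is (Elem ''has_lower'' (Var ''y'')) 1)
                     (ValLe ''entity'' (Var ''y'') ''lower'' (Var ''y'')))
               (Conj (Is (Elem ''has_upper'' (Var ''y'')) 1)
                     (Neg (ValLe ''entity'' (Var ''y'') ''upper'' (Var ''y''))))))"

text \<open>Inner nodes get a row too, so that row numbers are node numbers. \<open>agree\<close>
  stays 1 exactly if \<open>e\<close> follows the branch.\<close>

definition inspect :: com where
  "inspect = Assign ''live'' (Const 1) ;; Assign ''agree'' (Const 1) ;;
     For ''y'' ''features''
       (Cond cell_empty (Assign ''live'' (Const 0)) Skip ;;
        Cond cell_excludes
          (NatStore ''conflict'' (Plus (Var ''row'') (Var ''y'')) (Const 1) ;;
           Assign ''agree'' (Const 0))
          (NatStore ''conflict'' (Plus (Var ''row'') (Var ''y'')) (Const 0)))"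

text \<open>Inner nodes are entered as not live, so that \<open>is_adverse\<close> need not ask
  whether a node is a leaf. A leaf without conflict supplies the prediction for
  \<open>e\<close>.\<close>

definition record_node :: com where
  "record_node =
     Cond (Is (Elem ''kind'' (Var ''v'')) 0)
       (NatStore ''live'' (Var ''v'') (Var ''live'') ;;
        Cond (Is (Var ''agree'') 1) (Assign ''prediction'' (Elem ''class'' (Var ''v''))) Skip)
       (NatStore ''live'' (Var ''v'') (Const 0)) ;;
     Assign ''row'' (Plus (Var ''row'') (Var ''features''))"

definition build_table :: com where
  "build_table = Assign ''row'' (Const 0) ;;
     For ''v'' ''nodes'' (reset_cells ;; walk ;; inspect ;; record_node)"

definition compare_rows :: com where
  "compare_rows = Assign ''outside'' (Const 0) ;;
     For ''y'' ''features''
       (Cond (Conj (Is (Elem ''conflict'' (Plus (Var ''row'') (Var ''y''))) 1)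
                   (Or (Is (Elem ''conflict'' (Plus (Var ''row0'') (Var ''y''))) 0)
                       (Equal (Var ''y'') (Var ''query''))))
          (Assign ''outside'' (Const 1)) Skip)"

abbreviation is_adverse :: "name \<Rightarrow> test" where
  "is_adverse v \<equiv> Conj (Is (Elem ''live'' (Var v)) 1)
     (Neg (Equal (Elem ''class'' (Var v)) (Var ''prediction'')))"

text \<open>The row at \<open>row0\<close> is compared with all rows even if its own node is not
  adverse. That check is left to \<open>search\<close>, as making it earlier saves nothing in the
  worst case.\<close>

definition test_leaf :: com where
  "test_leaf = Assign ''minimal'' (Const 1) ;; Assign ''row'' (Const 0) ;;
     For ''w'' ''nodes''
       (compare_rows ;;
        Cond (Conj (Is (Var ''outside'') 0) (is_adverse ''w''))
          (Assign ''minimal'' (Const 0)) Skip ;;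
        Assign ''row'' (Plus (Var ''row'') (Var ''features'')))"

definition search :: com where
  "search = Assign ''answer'' (Const 0) ;; Assign ''row0'' (Const 0) ;;
     For ''v'' ''nodes''
       (test_leaf ;;
        Cond (Conj (Is (Var ''minimal'') 1)
                (Conj (is_adverse ''v'')
                   (Is (Elem ''conflict'' (Plus (Var ''row0'') (Var ''query''))) 1)))
          (Assign ''answer'' (Const 1)) Skip ;;
        Assign ''row0'' (Plus (Var ''row0'') (Var ''features'')))"

section \<open>Correctness of the program\<close>

lemma store_apply: "store m a i w b j = (if a = b \<and> j = i then w else m b j)"
  by (auto simp: store_def)

locale encoded_instance = tree_instance X D k T e x
  for X :: "'f set" and D :: "'f \<Rightarrow> 'c feature_domain" and k :: nat
    and T :: "('f, 'c) dtree" and e :: "('f, 'c) entity" and x :: 'f +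
  fixes fs :: "'f list"
  assumes distinct_fs: "distinct fs" and set_fs: "set fs = X"
begin

abbreviation n :: nat where "n \<equiv> length fs"
abbreviation N :: nat where "N \<equiv> num_nodes T"

text \<open>The part of the memory that the program reads and never writes. The state components are
  separate arguments so that updates can be simplified away one component at a time.\<close>

definition inputs ::
  "(name \<Rightarrow> nat) \<Rightarrow> (name \<Rightarrow> nat \<Rightarrow> nat) \<Rightarrow> (name \<Rightarrow> nat \<Rightarrow> 'c feature_value) \<Rightarrow> (name \<Rightarrow> nat \<Rightarrow> 'c set) \<Rightarrow> bool"
  where "inputs R A V S \<longleftrightarrow> (let s0 = input_state fs D k T e x in
    (\<forall>a\<in>{''features'', ''nodes'', ''query''}. R a = reg s0 a) \<and>
    (\<forall>a\<in>{''domain_kind'', ''kind'', ''class'', ''feature'', ''left'', ''right''}. A a = nat_arrays s0 a) \<and>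
    (\<forall>a\<in>{''entity'', ''threshold''}. V a = val_arrays s0 a) \<and>
    (\<forall>a\<in>{''domain'', ''set''}. S a = set_arrays s0 a))"

lemma inputs_update [simp]:
  "a \<notin> {''features'', ''nodes'', ''query''} \<Longrightarrow> inputs (R(a := i)) A V S = inputs R A V S"
  "a \<notin> {''domain_kind'', ''kind'', ''class'', ''feature'', ''left'', ''right''} \<Longrightarrow>
     inputs R (store A a j i) V S = inputs R A V S"
  "a \<notin> {''entity'', ''threshold''} \<Longrightarrow> inputs R A (store V a j v) S = inputs R A V S"
  "a \<notin> {''domain'', ''set''} \<Longrightarrow> inputs R A V (store S a j B) = inputs R A V S"
  by (auto simp: inputs_def Let_def store_def)

lemma inputs_initial:
  "s = input_state fs D k T e x \<Longrightarrow> inputs (reg s) (nat_arrays s) (val_arrays s) (set_arrays s)"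
  by (simp add: inputs_def Let_def)

lemma inputs_reg:
  assumes "inputs R A V S"
  shows "R ''features'' = n" "R ''nodes'' = N" "R ''query'' = index_of fs x"
  using assms by (simp_all add: inputs_def Let_def input_state_def)

lemma inputs_feature:
  assumes "inputs R A V S" "j < n"
  shows "A ''domain_kind'' j = domain_kind (D (fs ! j))" "V ''entity'' j = e (fs ! j)"
    "S ''domain'' j = domain_set (D (fs ! j))"
  using assms by (simp_all add: inputs_def Let_def input_state_def array_def)

lemma inputs_node:
  assumes "inputs R A V S" "v < N"
  shows "A ''kind'' v = node_kind (preorder T ! v)" "A ''class'' v = node_class (preorder T ! v)"
    "A ''feature'' v = node_feature fs (preorder T ! v)"
    "A ''left'' v = left_child v (preorder T ! v)" "A ''right'' v = right_child v (preorder T ! v)"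
    "V ''threshold'' v = node_threshold (preorder T ! v)" "S ''set'' v = node_set (preorder T ! v)"
  using assms by (simp_all add: inputs_def Let_def input_state_def array_def)

lemma index_of_eq: "j < n \<Longrightarrow> index_of fs (fs ! j) = j"
  unfolding index_of_def using distinct_fs by (auto simp: nth_eq_iff_index_eq intro!: the_equality)

lemma index_of:
  assumes "y \<in> X"
  shows "index_of fs y < n" "fs ! index_of fs y = y"
  using assms set_fs index_of_eq by (auto simp: in_set_conv_nth)

lemma n_pos: "0 < n"
  using x_mem set_fs by (cases fs) auto

abbreviation on :: "_ \<Rightarrow> 'c state \<Rightarrow> bool" where
  "on P s \<equiv> P (reg s) (nat_arrays s) (val_arrays s) (set_arrays s)"

lemma ball_X: "(\<forall>y\<in>X. P y) \<longleftrightarrow> (\<forall>j<n. P (fs ! j))"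
  by (simp add: all_set_conv_all_nth flip: set_fs)

section \<open>Cells along a growing branch\<close>

definition cells :: "(('f, 'c) dtree \<times> bool) list \<Rightarrow> (name \<Rightarrow> nat \<Rightarrow> nat) \<Rightarrow>
    (name \<Rightarrow> nat \<Rightarrow> 'c feature_value) \<Rightarrow> (name \<Rightarrow> nat \<Rightarrow> 'c set) \<Rightarrow> bool" where
  "cells ls A V S \<longleftrightarrow> (\<forall>j<n. tracked (D (fs ! j)) (allowed D ls (fs ! j)) (S ''cell'' j)
     (A ''has_lower'' j) (V ''lower'' j) (A ''has_upper'' j) (V ''upper'' j))"

lemma cells_update [simp]:
  "a \<notin> {''has_lower'', ''has_upper''} \<Longrightarrow> cells ls (store A a i j) V S = cells ls A V S"
  by (simp add: cells_def store_apply)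

lemma cells_snoc_set:
  assumes "cells ls A V S" "decision_tree X D k t" "node_kind t = 1" "j0 = node_feature fs t"
  shows "cells (ls @ [(t, True)]) A V (store S ''cell'' j0 (S ''cell'' j0 \<inter> node_set t))"
    and "cells (ls @ [(t, False)]) A V (store S ''cell'' j0 (S ''cell'' j0 - node_set t))"
proof -
  obtain y B l r C where t: "t = CatNode y B l r" "D y = Categorical C" "y \<in> X"
    using assms(2,3) by (cases t) auto
  have j0: "j0 < n" "fs ! j0 = y" using t assms(4) index_of by simp_all
  \<comment> \<open>Distinctness of \<open>fs\<close> confines the change to a single cell.\<close>
  have same: "y = fs ! j \<longleftrightarrow> j = j0" if "j < n" for j
    using that j0 distinct_fs nth_eq_iff_index_eq by blast
  have tr: "tracked (Categorical C) (allowed D ls y) (S ''cell'' j0)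
     (A ''has_lower'' j0) (V ''lower'' j0) (A ''has_upper'' j0) (V ''upper'' j0)"
    using assms(1) j0 t by (auto simp: cells_def)
  show "cells (ls @ [(t, True)]) A V (store S ''cell'' j0 (S ''cell'' j0 \<inter> node_set t))"
    "cells (ls @ [(t, False)]) A V (store S ''cell'' j0 (S ''cell'' j0 - node_set t))"
    using assms(1) tracked_set[OF tr, of B] j0 t
    by (simp_all add: cells_def allowed_snoc store_apply same del: tracked.simps)
qed

lemma cells_snoc_bound:
  assumes "cells ls A V S" "decision_tree X D k t" "node_kind t \<noteq> 0" "node_kind t \<noteq> 1"
    "j0 = node_feature fs t" "b = node_threshold t"
  shows "A ''has_upper'' j0 = 1 \<and> val_le (V ''upper'' j0) b \<Longrightarrow> cells (ls @ [(t, True)]) A V S"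
    and "\<not> (A ''has_upper'' j0 = 1 \<and> val_le (V ''upper'' j0) b) \<Longrightarrow>
      cells (ls @ [(t, True)]) (store A ''has_upper'' j0 1) (store V ''upper'' j0 b) S"
    and "A ''has_lower'' j0 = 1 \<and> val_le b (V ''lower'' j0) \<Longrightarrow> cells (ls @ [(t, False)]) A V S"
    and "\<not> (A ''has_lower'' j0 = 1 \<and> val_le b (V ''lower'' j0)) \<Longrightarrow>
      cells (ls @ [(t, False)]) (store A ''has_lower'' j0 1) (store V ''lower'' j0 b) S"
proof -
  \<comment> \<open>Labels equal to the maximum of the domain are excluded from decision trees;
    \<open>less_le\<close> turns this into \<open>ereal c < M\<close>.\<close>
  obtain y c l r m M where t: "t = NumNode y c l r" "D y = Numerical m M" "y \<in> X" "b = NumVal c"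
    and c: "m \<le> ereal c" "ereal c < M"
    using assms(2,3,4,6) by (cases t) (auto simp: less_le)
  have j0: "j0 < n" "fs ! j0 = y" using t assms(5) index_of by simp_all
  have same: "y = fs ! j \<longleftrightarrow> j = j0" if "j < n" for j
    using that j0 distinct_fs nth_eq_iff_index_eq by blast
  have tr: "tracked (Numerical m M) (allowed D ls y) (S ''cell'' j0)
     (A ''has_lower'' j0) (V ''lower'' j0) (A ''has_upper'' j0) (V ''upper'' j0)"
    using assms(1) j0 t by (auto simp: cells_def simp del: tracked.simps)
  note simps = cells_def allowed_snoc store_apply same
  show "cells (ls @ [(t, True)]) A V S" if "A ''has_upper'' j0 = 1 \<and> val_le (V ''upper'' j0) b"
    using assms(1) tracked_le(1)[OF tr c] that j0 t
    by (simp add: simps del: tracked.simps One_nat_def)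
  show "cells (ls @ [(t, True)]) (store A ''has_upper'' j0 1) (store V ''upper'' j0 b) S"
    if "\<not> (A ''has_upper'' j0 = 1 \<and> val_le (V ''upper'' j0) b)"
    using assms(1) tracked_le(2)[OF tr c] that j0 t
    by (simp add: simps del: tracked.simps One_nat_def)
  show "cells (ls @ [(t, False)]) A V S" if "A ''has_lower'' j0 = 1 \<and> val_le b (V ''lower'' j0)"
    using assms(1) tracked_gt(1)[OF tr c] that j0 t
    by (simp add: simps del: tracked.simps One_nat_def)
  show "cells (ls @ [(t, False)]) (store A ''has_lower'' j0 1) (store V ''lower'' j0 b) S"
    if "\<not> (A ''has_lower'' j0 = 1 \<and> val_le b (V ''lower'' j0))"
    using assms(1) tracked_gt(2)[OF tr c] that j0 t
    by (simp add: simps del: tracked.simps One_nat_def)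
qed

section \<open>Position of a walk in the preorder numbering\<close>

definition on_branch :: "nat \<Rightarrow> nat \<Rightarrow> ('f, 'c) dtree \<Rightarrow> (('f, 'c) dtree \<times> bool) list \<Rightarrow> bool" where
  "on_branch v u t ls \<longleftrightarrow> u \<le> v \<and> v < u + num_nodes t \<and> u + num_nodes t \<le> N \<and>
     (\<forall>i<num_nodes t. preorder T ! (u + i) = preorder t ! i) \<and> decision_tree X D k t \<and>
     branch T v = ls @ branch t (v - u)"

lemma on_branch_root: "v < N \<Longrightarrow> on_branch v 0 T []"
  using tree by (simp add: on_branch_def)

text \<open>The remaining branch is \<open>branch t 0\<close>, which is empty.\<close>

lemma on_branch_end: "on_branch v v t ls \<Longrightarrow> ls = branch T v"
  by (cases t) (auto simp: on_branch_def)

lemma on_branch_node: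
  assumes "on_branch v u t ls"
  shows "preorder T ! u = t" "decision_tree X D k t" "u < N" "u \<noteq> v \<Longrightarrow> node_kind t \<noteq> 0"
proof -
  have "preorder T ! (u + 0) = preorder t ! 0"
    using assms num_nodes_pos unfolding on_branch_def by blast
  then show "preorder T ! u = t" by (cases t) auto
  show "decision_tree X D k t" using assms by (simp add: on_branch_def)
  show "u < N" using assms num_nodes_pos[of t] by (simp add: on_branch_def)
  show "node_kind t \<noteq> 0" if "u \<noteq> v" using assms that by (cases t) (auto simp: on_branch_def)
qed

lemma on_branch_left:
  assumes b: "on_branch v u t ls" "u \<noteq> v" and v: "v < right_child u t"
  shows "left_child u t = u + 1 \<and> (\<exists>l. on_branch v (u + 1) l (ls @ [(t, True)]))"
proof -
  have nth: "\<forall>i<num_nodes t. preorder T ! (u + i) = preorder t ! i"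
    using b by (simp add: on_branch_def)
  have pre: "preorder T ! (u + 1 + i) = preorder t ! (1 + i)" if "1 + i < num_nodes t" for i
    using nth[rule_format, OF that] by (simp add: add.assoc)
  show ?thesis
  proof (cases t)
    case (CatNode y B l r)
    then have "on_branch v (u + 1) l (ls @ [(t, True)])"
      using b v pre by (auto simp: on_branch_def preorder_nth simp del: preorder.simps)
    with CatNode show ?thesis by auto
  next
    case (NumNode y B l r)
    then have "on_branch v (u + 1) l (ls @ [(t, True)])"
      using b v pre by (auto simp: on_branch_def preorder_nth simp del: preorder.simps)
    with NumNode show ?thesis by auto
  \<comment> \<open>A leaf has right child 0, which no \<open>v\<close> lies below.\<close>
  qed (use v in simp)
qed

lemma on_branch_right:
  assumes b: "on_branch v u t ls" "u \<noteq> v" and v: "\<not> v < right_child u t"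
  shows "u < right_child u t \<and> (\<exists>r. on_branch v (right_child u t) r (ls @ [(t, False)]))"
proof -
  have nth: "\<forall>i<num_nodes t. preorder T ! (u + i) = preorder t ! i"
    using b by (simp add: on_branch_def)
  have pre: "preorder T ! (u + 1 + m + i) = preorder t ! (1 + m + i)" if "1 + m + i < num_nodes t" for m i
    using nth[rule_format, OF that] by (simp add: add.assoc)
  \<comment> \<open>Here the value 0 of \<open>right_child\<close> does not rule out a leaf;
    \<open>u \<noteq> v\<close> does, since a leaf occupies one number only.\<close>
  have "node_kind t \<noteq> 0" using on_branch_node[OF b(1)] b(2) by blast
  show ?thesis
  proof (cases t)
    case (CatNode y B l r)
    then have "on_branch v (u + 1 + num_nodes l) r (ls @ [(t, False)])"
      using b v pre[of "num_nodes l"]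
      by (auto simp: on_branch_def preorder_nth simp del: preorder.simps)
    with CatNode show ?thesis by auto
  next
    case (NumNode y B l r)
    then have "on_branch v (u + 1 + num_nodes l) r (ls @ [(t, False)])"
      using b v pre[of "num_nodes l"]
      by (auto simp: on_branch_def preorder_nth simp del: preorder.simps)
    with NumNode show ?thesis by auto
  qed (use \<open>node_kind t \<noteq> 0\<close> in simp)
qed

section \<open>The table of conflict sets\<close>

definition table :: "nat \<Rightarrow> (name \<Rightarrow> nat \<Rightarrow> nat) \<Rightarrow> bool" where
  "table v A \<longleftrightarrow> (\<forall>a<v. (\<forall>j<n. A ''conflict'' (a * n + j) = of_bool (conflict a (fs ! j))) \<and>
     A ''live'' a = of_bool (live_leaf a))"

lemma table_update [simp]:
  "a \<notin> {''conflict'', ''live''} \<Longrightarrow> table v (store A a i j) = table v A"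
  by (simp add: table_def store_apply)

definition reached :: "nat \<Rightarrow> bool" where
  "reached v \<longleftrightarrow> node_kind (preorder T ! v) = 0 \<and> (\<forall>y\<in>X. \<not> conflict v y)"

text \<open>Nothing is known of \<open>prediction\<close> before a leaf without conflict has been
  met. By \<open>reached_class\<close> any such leaf has the right class, so overwriting is
  harmless.\<close>

definition filling :: "nat \<Rightarrow> (name \<Rightarrow> nat) \<Rightarrow> (name \<Rightarrow> nat \<Rightarrow> nat) \<Rightarrow>
    (name \<Rightarrow> nat \<Rightarrow> 'c feature_value) \<Rightarrow> (name \<Rightarrow> nat \<Rightarrow> 'c set) \<Rightarrow> bool" where
  "filling v R A V S \<longleftrightarrow> inputs R A V S \<and> R ''v'' = v \<and> R ''row'' = v * n \<and> table v A \<and>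
     ((\<exists>a<v. reached a) \<longrightarrow> R ''prediction'' = predict T e)"

lemma filling_update [simp]:
  "a \<notin> {''features'', ''nodes'', ''query'', ''v'', ''row'', ''prediction''} \<Longrightarrow>
     filling v (R(a := i)) A V S = filling v R A V S"
  "a \<notin> {''domain_kind'', ''kind'', ''class'', ''feature'', ''left'', ''right'', ''conflict'', ''live''} \<Longrightarrow>
     filling v R (store A a j i) V S = filling v R A V S"
  "a \<notin> {''entity'', ''threshold''} \<Longrightarrow> filling v R A (store V a j w) S = filling v R A V S"
  "a \<notin> {''domain'', ''set''} \<Longrightarrow> filling v R A V (store S a j B) = filling v R A V S"
  unfolding filling_def by (auto simp: fun_upd_other)

lemma filling_inputs: "filling v R A V S \<Longrightarrow> inputs R A V S"
  by (simp add: filling_def)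

text \<open>Row \<open>a\<close> ends no later than row \<open>v\<close> begins, so writing row
  \<open>v\<close> preserves all finished rows.\<close>

lemma row_neq: "a < v \<Longrightarrow> i < n \<Longrightarrow> a * n + i \<noteq> v * n + j"
proof -
  assume "a < v" "i < n"
  then have "a * n + n \<le> v * n" by (metis Suc_leI add.commute mult_Suc mult_le_mono1)
  with \<open>i < n\<close> show ?thesis by simp
qed

lemma filling_conflict:
  "filling v R A V S \<Longrightarrow> filling v R (store A ''conflict'' (v * n + j) c) V S"
  by (auto simp: filling_def table_def store_apply row_neq)

lemma runs_reset_cells:
  assumes "on (filling v) s"
  shows "runs reset_cells (2 + n * 5) (\<lambda>s'. on (filling v) s' \<and>
    cells [] (nat_arrays s') (val_arrays s') (set_arrays s')) s"
proof -
  let ?I = "\<lambda>j (s :: 'c state). on (filling v) s \<and>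
    (\<forall>i<j. tracked (D (fs ! i)) (domain_values (D (fs ! i))) (set_arrays s ''cell'' i)
     (nat_arrays s ''has_lower'' i) (val_arrays s ''lower'' i) (nat_arrays s ''has_upper'' i) (val_arrays s ''upper'' i))"
  have "runs reset_cells (2 + n * 5) (\<lambda>s'. reg s' ''features'' = n \<and> ?I n s') s"
    unfolding reset_cells_def
  proof (rule runs_For[where c = 3 and I = ?I])
    fix j and s :: "'c state" assume j: "j < n" "reg s ''y'' = j" "reg s ''features'' = n" and I: "?I j s"
    note start = tracked_start[of "D (fs ! j)" "val_arrays s ''lower'' j" "val_arrays s ''upper'' j"]
    show "runs (SetMove ''cell'' (Var ''y'') ''domain'' (Var ''y'') ;;
      NatStore ''has_lower'' (Var ''y'') (Const 0) ;;
      NatStore ''has_upper'' (Var ''y'') (Const 0)) 3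
      (\<lambda>s'. reg s' ''y'' = j \<and> reg s' ''features'' = n \<and> ?I (Suc j) (s'\<lparr>reg := (reg s')(''y'' := Suc j)\<rparr>)) s"
      using I j start inputs_feature[OF filling_inputs, of v "reg s" "nat_arrays s" "val_arrays s" "set_arrays s" j]
      by (intro runs_straight) (auto simp: store_apply less_Suc_eq simp del: tracked.simps)
  next
    show "?I 0 (s\<lparr>reg := (reg s)(''y'' := 0)\<rparr>)" using assms by simp
  qed (use assms inputs_reg(1)[OF filling_inputs[OF assms]] in auto)
  then show ?thesis by (rule runs_mono) (auto simp: cells_def)
qed

text \<open>The subtree \<open>t\<close> at \<open>u\<close> and the path \<open>ls\<close> to it
  are ghost data of the invariant. Since \<open>u\<close> grows in each round without passing
  \<open>v\<close>, the distance \<open>v - u\<close> bounds the number of rounds; a round costs 7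
  plus the test.\<close>

lemma runs_walk:
  assumes "on (filling v) s" "cells [] (nat_arrays s) (val_arrays s) (set_arrays s)" "v < N"
  shows "runs walk (2 + N * 8) (\<lambda>s'. on (filling v) s' \<and>
    cells (branch T v) (nat_arrays s') (val_arrays s') (set_arrays s')) s"
  unfolding walk_def
proof (rule runs_Seq)
  let ?I = "\<lambda>s. on (filling v) s \<and> (\<exists>t ls. on_branch v (reg s ''u'') t ls \<and>
    cells ls (nat_arrays s) (val_arrays s) (set_arrays s))"
  let ?b = "Neg (Equal (Var ''u'') (Var ''v''))"
  show "runs (Assign ''u'' (Const 0)) 1 (\<lambda>s'. ?I s' \<and> reg s' ''u'' = 0) s"
    using assms on_branch_root by (intro runs_straight) auto
  fix s' :: "'c state" assume I: "?I s' \<and> reg s' ''u'' = 0"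
  have "runs (While ?b descend) (1 + (v - reg s' ''u'') * (7 + 1)) (\<lambda>s'. ?I s' \<and> \<not> tval ?b s') s'"
  proof (rule runs_While)
    fix s :: "'c state" assume I: "?I s" and b: "tval ?b s"
    define u where "u = reg s ''u''"
    obtain t ls where t: "on_branch v u t ls" and c: "cells ls (nat_arrays s) (val_arrays s) (set_arrays s)"
      using I u_def by blast
    have v: "reg s ''v'' = v" using I by (simp add: filling_def)
    have uv: "u \<noteq> v" using b v u_def by simp
    note node = on_branch_node(1,2,3)[OF t] on_branch_node(4)[OF t uv]
    have inp: "on inputs s" using I filling_inputs by blast
    note arr = inputs_node[OF inp node(3), unfolded node(1)]
    have u_le: "u \<le> v" using t by (simp add: on_branch_def)
    show "runs descend 7 (\<lambda>s'. ?I s' \<and> v - reg s' ''u'' < v - reg s ''u'') s"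
    proof (cases "v < right_child u t")
      case True
      obtain l where l: "left_child u t = Suc u" "on_branch v (Suc u) l (ls @ [(t, True)])"
        using on_branch_left[OF t uv True] by auto
      have ex: "\<exists>t ls. on_branch v (Suc u) t ls \<and> cells ls A V S" if "cells (ls @ [(t, True)]) A V S" for A V S
        using l that by auto
      have lt: "v - Suc u < v - u" using u_le uv by simp
      note rules = u_def[symmetric] v l(1) arr lt True
      consider (set) "node_kind t = 1"
        | (keep) "node_kind t \<noteq> 1" "nat_arrays s ''has_upper'' (node_feature fs t) = 1 \<and>
            val_le (val_arrays s ''upper'' (node_feature fs t)) (node_threshold t)"
        | (move) "node_kind t \<noteq> 1" "\<not> (nat_arrays s ''has_upper'' (node_feature fs t) = 1 \<and>
            val_le (val_arrays s ''upper'' (node_feature fs t)) (node_threshold t))" by blast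
      then show ?thesis
      proof cases
        case set
        show ?thesis unfolding descend_def
          using I ex[OF cells_snoc_set(1)[OF c node(2) set refl]]
          by (intro runs_straight) (simp_all add: rules store_apply set del: One_nat_def)
      next
        case keep
        show ?thesis unfolding descend_def
          using I ex[OF cells_snoc_bound(1)[OF c node(2,4) keep(1) refl refl keep(2)]]
          by (intro runs_straight) (simp_all add: rules store_apply keep del: One_nat_def)
      next
        case move
        show ?thesis unfolding descend_def
          using I ex[OF cells_snoc_bound(2)[OF c node(2,4) move(1) refl refl move(2)]]
          by (intro runs_straight) (simp_all add: rules store_apply move del: One_nat_def)
      qed
    next
      case False
      obtain r where r: "u < right_child u t" "on_branch v (right_child u t) r (ls @ [(t, False)])"
        using on_branch_right[OF t uv False] by blast
      have ex: "\<exists>r ls. on_branch v (right_child u t) r ls \<and> cells ls A V S"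
        if "cells (ls @ [(t, False)]) A V S" for A V S
        using r that by auto
      have lt: "v - right_child u t < v - u" using r u_le uv by simp
      note rules = u_def[symmetric] v arr lt False
      consider (set) "node_kind t = 1"
        | (keep) "node_kind t \<noteq> 1" "nat_arrays s ''has_lower'' (node_feature fs t) = 1 \<and>
            val_le (node_threshold t) (val_arrays s ''lower'' (node_feature fs t))"
        | (move) "node_kind t \<noteq> 1" "\<not> (nat_arrays s ''has_lower'' (node_feature fs t) = 1 \<and>
            val_le (node_threshold t) (val_arrays s ''lower'' (node_feature fs t)))" by blast
      then show ?thesis
      proof cases
        case set
        show ?thesis unfolding descend_def
          using I ex[OF cells_snoc_set(2)[OF c node(2) set refl]]
          by (intro runs_straight) (simp_all add: rules store_apply set del: One_nat_def)
      next
        case keep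
        show ?thesis unfolding descend_def
          using I ex[OF cells_snoc_bound(3)[OF c node(2,4) keep(1) refl refl keep(2)]]
          by (intro runs_straight) (simp_all add: rules store_apply keep del: One_nat_def)
      next
        case move
        show ?thesis unfolding descend_def
          using I ex[OF cells_snoc_bound(4)[OF c node(2,4) move(1) refl refl move(2)]]
          by (intro runs_straight) (simp_all add: rules store_apply move del: One_nat_def)
      qed
    qed
  qed (use I in blast)
  then show "runs (While ?b descend) (1 + N * 8) (\<lambda>s'. on (filling v) s' \<and>
    cells (branch T v) (nat_arrays s') (val_arrays s') (set_arrays s')) s'"
  proof (rule runs_mono)
    show "1 + (v - reg s' ''u'') * (7 + 1) \<le> 1 + N * 8" using \<open>v < N\<close> by simp
    fix s'' :: "'c state" assume "?I s'' \<and> \<not> tval ?b s''"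
    then show "on (filling v) s'' \<and> cells (branch T v) (nat_arrays s'') (val_arrays s'') (set_arrays s'')"
      using on_branch_end by (auto simp: filling_def)
  qed
qed simp

lemma tval_cell_empty:
  assumes "on inputs s" "cells (branch T v) (nat_arrays s) (val_arrays s) (set_arrays s)"
    "reg s ''y'' = j" "j < n"
  shows "tval cell_empty s \<longleftrightarrow> allowed D (branch T v) (fs ! j) = {}"
proof -
  have "fs ! j \<in> X" using assms(4) set_fs by auto
  \<comment> \<open>The value of \<open>e\<close> witnesses nonemptiness, which
    \<open>tracked_empty_iff\<close> demands.\<close>
  then have "domain_values (D (fs ! j)) \<noteq> {}" using entity_value by blast
  with assms(2,4) have "allowed D (branch T v) (fs ! j) = {} \<longleftrightarrow>
     (if domain_kind (D (fs ! j)) = 1 then set_arrays s ''cell'' j = {}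
      else nat_arrays s ''has_lower'' j = 1 \<and> nat_arrays s ''has_upper'' j = 1 \<and>
        val_le (val_arrays s ''upper'' j) (val_arrays s ''lower'' j))"
    unfolding cells_def by (intro tracked_empty_iff) auto
  then show ?thesis
    using inputs_feature[OF assms(1,4)] assms(3) by (auto simp: cell_empty_def)
qed

lemma tval_cell_excludes:
  assumes "on inputs s" "cells (branch T v) (nat_arrays s) (val_arrays s) (set_arrays s)"
    "reg s ''y'' = j" "j < n"
  shows "tval cell_excludes s \<longleftrightarrow> conflict v (fs ! j)"
proof -
  have "fs ! j \<in> X" using assms(4) set_fs by auto
  then have "e (fs ! j) \<in> domain_values (D (fs ! j))" using entity_value by blast
  with assms(2,4) have "e (fs ! j) \<in> allowed D (branch T v) (fs ! j) \<longleftrightarrow>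
     (if domain_kind (D (fs ! j)) = 1 then e (fs ! j) \<in> CatVal ` set_arrays s ''cell'' j
      else (nat_arrays s ''has_lower'' j = 1 \<longrightarrow> \<not> val_le (e (fs ! j)) (val_arrays s ''lower'' j)) \<and>
        (nat_arrays s ''has_upper'' j = 1 \<longrightarrow> val_le (e (fs ! j)) (val_arrays s ''upper'' j)))"
    unfolding cells_def by (intro tracked_mem_iff) auto
  then show ?thesis
    using inputs_feature[OF assms(1,4)] assms(3) by (auto simp: cell_excludes_def conflict_def)
qed

lemma runs_inspect:
  assumes "on (filling v) s" "cells (branch T v) (nat_arrays s) (val_arrays s) (set_arrays s)"
  shows "runs inspect (4 + n * 7) (\<lambda>s'. on (filling v) s' \<and>
    (\<forall>j<n. nat_arrays s' ''conflict'' (v * n + j) = of_bool (conflict v (fs ! j))) \<and>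
    reg s' ''live'' = of_bool (\<forall>y\<in>X. allowed D (branch T v) y \<noteq> {}) \<and>
    reg s' ''agree'' = of_bool (\<forall>y\<in>X. \<not> conflict v y)) s"
proof -
  let ?I = "\<lambda>j (s :: 'c state). on (filling v) s \<and>
    cells (branch T v) (nat_arrays s) (val_arrays s) (set_arrays s) \<and>
    (\<forall>i<j. nat_arrays s ''conflict'' (v * n + i) = of_bool (conflict v (fs ! i))) \<and>
    reg s ''live'' = of_bool (\<forall>i<j. allowed D (branch T v) (fs ! i) \<noteq> {}) \<and>
    reg s ''agree'' = of_bool (\<forall>i<j. \<not> conflict v (fs ! i))"
  have "runs inspect (4 + n * 7) (\<lambda>s'. reg s' ''features'' = n \<and> ?I n s') s"
    unfolding inspect_def
  proof (rule runs_Seq)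
    let ?R = "\<lambda>s. on (filling v) s \<and>
      cells (branch T v) (nat_arrays s) (val_arrays s) (set_arrays s) \<and> reg s ''live'' = 1"
    show "runs (Assign ''live'' (Const 1)) 1 ?R s"
      using assms by (intro runs_straight) simp_all
    fix s :: "'c state" assume R: "?R s"
    let ?R' = "\<lambda>s. ?R s \<and> reg s ''agree'' = 1"
    show "runs (Assign ''agree'' (Const 1) ;; For ''y'' ''features''
       (Cond cell_empty (Assign ''live'' (Const 0)) Skip ;;
        Cond cell_excludes
          (NatStore ''conflict'' (Plus (Var ''row'') (Var ''y'')) (Const 1) ;;
           Assign ''agree'' (Const 0))
          (NatStore ''conflict'' (Plus (Var ''row'') (Var ''y'')) (Const 0)))) (3 + n * 7)
        (\<lambda>s'. reg s' ''features'' = n \<and> ?I n s') s"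
    proof (rule runs_Seq)
      show "runs (Assign ''agree'' (Const 1)) 1 ?R' s"
        using R by (intro runs_straight) simp_all
      fix s :: "'c state" assume R': "?R' s"
      show "runs (For ''y'' ''features''
       (Cond cell_empty (Assign ''live'' (Const 0)) Skip ;;
        Cond cell_excludes
          (NatStore ''conflict'' (Plus (Var ''row'') (Var ''y'')) (Const 1) ;;
           Assign ''agree'' (Const 0))
          (NatStore ''conflict'' (Plus (Var ''row'') (Var ''y'')) (Const 0)))) (2 + n * 7)
        (\<lambda>s'. reg s' ''features'' = n \<and> ?I n s') s"
      proof (rule runs_For[where c = 5 and I = ?I])
        fix j and s :: "'c state"
        assume j: "j < n" "reg s ''y'' = j" "reg s ''features'' = n" and I: "?I j s"
        have f: "on (filling v) s" and c: "cells (branch T v) (nat_arrays s) (val_arrays s) (set_arrays s)"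
          using I by simp_all
        have row: "reg s ''row'' = v * n" using f by (simp add: filling_def)
        \<comment> \<open>The second test may run after \<open>live\<close> has been cleared, so its
          meaning is needed in that state as well.\<close>
        have "tval cell_excludes (s\<lparr>reg := (reg s)(''live'' := 0)\<rparr>) \<longleftrightarrow> conflict v (fs ! j)"
          using j c filling_inputs[OF f] by (intro tval_cell_excludes) simp_all
        note tests = tval_cell_empty[OF filling_inputs[OF f] c j(2,1)]
          tval_cell_excludes[OF filling_inputs[OF f] c j(2,1)] this
        show "runs (Cond cell_empty (Assign ''live'' (Const 0)) Skip ;;
            Cond cell_excludes
              (NatStore ''conflict'' (Plus (Var ''row'') (Var ''y'')) (Const 1) ;;
               Assign ''agree'' (Const 0))
              (NatStore ''conflict'' (Plus (Var ''row'') (Var ''y'')) (Const 0))) 5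
            (\<lambda>s'. reg s' ''y'' = j \<and> reg s' ''features'' = n \<and>
              ?I (Suc j) (s'\<lparr>reg := (reg s')(''y'' := Suc j)\<rparr>)) s"
          using I j row filling_conflict[OF f]
          by (intro runs_straight) (simp_all add: tests All_less_Suc store_apply)
      next
        show "?I 0 (s\<lparr>reg := (reg s)(''y'' := 0)\<rparr>)" using R' by simp
      qed (use R' inputs_reg(1)[OF filling_inputs] in auto)
    qed simp
  qed simp
  then show ?thesis by (rule runs_mono) (simp_all add: ball_X)
qed

lemma reached_class:
  assumes "reached v" "v < N"
  shows "node_class (preorder T ! v) = predict T e"
proof -
  have "follows e (branch T v)"
    using assms(1) follows_iff_allowed[OF entity] by (simp add: reached_def conflict_def)
  moreover have "preorder T ! v = Leaf (node_class (preorder T ! v))"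
    using assms(1) by (simp add: reached_def flip: leaf_iff)
  ultimately show ?thesis using predict_of_branch[OF assms(2)] by metis
qed

text \<open>Ensures that \<open>prediction\<close> has been set once the table is complete.\<close>

lemma ex_reached: "\<exists>v<N. reached v"
proof -
  obtain v where "v < N" "preorder T ! v = Leaf (predict T e)" "follows e (branch T v)"
    using ex_branch_predict by blast
  then show ?thesis
    using follows_iff_allowed[OF entity] by (auto simp: reached_def conflict_def)
qed

lemma runs_record_node:
  assumes f: "on (filling v) s" and v: "v < N"
    and c: "\<forall>j<n. nat_arrays s ''conflict'' (v * n + j) = of_bool (conflict v (fs ! j))"
    and l: "reg s ''live'' = of_bool (\<forall>y\<in>X. allowed D (branch T v) y \<noteq> {})"
    and a: "reg s ''agree'' = of_bool (\<forall>y\<in>X. \<not> conflict v y)"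
  shows "runs record_node 5 (\<lambda>s'. reg s' ''v'' = v \<and> reg s' ''nodes'' = N \<and>
    on (filling (Suc v)) (s'\<lparr>reg := (reg s')(''v'' := Suc v)\<rparr>)) s"
proof -
  have inp: "on inputs s" and reg: "reg s ''v'' = v" "reg s ''row'' = v * n" and t: "table v (nat_arrays s)"
    and p: "(\<exists>a<v. reached a) \<longrightarrow> reg s ''prediction'' = predict T e"
    using f by (simp_all add: filling_def)
  have t': "table (Suc v) (store (nat_arrays s) ''live'' v (of_bool (live_leaf v)))"
    using t c by (auto simp: table_def All_less_Suc store_apply)
  have cls: "reached v \<Longrightarrow> node_class (preorder T ! v) = predict T e"
    using reached_class v by blast
  note node = inputs_node(1,2)[OF inp v] inputs_reg[OF inp]
  show ?thesis
  proof (cases "node_kind (preorder T ! v) = 0")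
    case True
    then have r: "reached v \<longleftrightarrow> reg s ''agree'' = 1" "live_leaf v \<longleftrightarrow> reg s ''live'' = 1"
      using a l by (simp_all add: reached_def live_leaf_def)
    have l': "of_bool (live_leaf v) = reg s ''live''" using r(2) l by simp
    show ?thesis unfolding record_node_def
      using True t' p inp cls
      by (intro runs_straight) (simp_all add: node reg filling_def Ex_less_Suc r(1) l' store_apply)
  next
    case False
    then have r: "\<not> reached v" "\<not> live_leaf v"
      by (simp_all add: reached_def live_leaf_def)
    show ?thesis unfolding record_node_def
      using False t' p inp
      by (intro runs_straight) (simp_all add: node reg filling_def Ex_less_Suc r)
  qed
qed

lemma runs_build_table:
  assumes "on inputs s"
  shows "runs build_table (38 * (n * N ^ 2)) (\<lambda>s'. on inputs s' \<and> table N (nat_arrays s') \<and>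
    reg s' ''prediction'' = predict T e) s"
proof -
  define K where "K = n * N"
  have K: "n \<le> K" "N \<le> K" "1 \<le> K"
    using n_pos num_nodes_pos[of T] by (simp_all add: K_def Suc_le_eq)
  have "runs build_table (3 + N * (33 * K + 2)) (\<lambda>s'. reg s' ''nodes'' = N \<and>
      on (filling N) (s'\<lparr>reg := (reg s')(''v'' := N)\<rparr>)) s"
    unfolding build_table_def
  proof (rule runs_Seq)
    let ?I = "\<lambda>v (s :: 'c state). on (filling v) s"
    show "runs (Assign ''row'' (Const 0)) 1 (\<lambda>s. on inputs s \<and> reg s ''row'' = 0) s"
      using assms by (intro runs_straight) simp_all
    fix s :: "'c state" assume s: "on inputs s \<and> reg s ''row'' = 0"
    have "runs (For ''v'' ''nodes'' (reset_cells ;; walk ;; inspect ;; record_node)) (2 + N * (33 * K + 2))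
        (\<lambda>s'. reg s' ''nodes'' = N \<and> ?I N s') s"
    proof (rule runs_For[where c = "33 * K" and I = ?I])
      fix v and s :: "'c state"
      assume v: "v < N" and f: "?I v s"
      show "runs (reset_cells ;; walk ;; inspect ;; record_node) (33 * K)
        (\<lambda>s'. reg s' ''v'' = v \<and> reg s' ''nodes'' = N \<and> ?I (Suc v) (s'\<lparr>reg := (reg s')(''v'' := Suc v)\<rparr>)) s"
      proof (rule runs_Seq[OF runs_reset_cells[OF f]], elim conjE,
          rule runs_Seq[OF runs_walk, where c = "9 + n * 7"], assumption+, rule v,
          elim conjE, rule runs_Seq[OF runs_inspect], assumption+, elim conjE, rule runs_record_node)
        \<comment> \<open>The four parts cost 13 + 12 n + 8 N in total, and 13 + 12 + 8 = 33, as
          \<open>K\<close> dominates 1, \<open>n\<close> and \<open>N\<close>.\<close>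
        show "2 + n * 5 + (11 + N * 8 + n * 7) \<le> 33 * K" using K by simp
      qed (use v in simp_all)
    next
      show "?I 0 (s\<lparr>reg := (reg s)(''v'' := 0)\<rparr>)"
        using s by (simp add: filling_def table_def)
    qed (use s inputs_reg in auto)
    then show "runs (For ''v'' ''nodes'' (reset_cells ;; walk ;; inspect ;; record_node)) (2 + N * (33 * K + 2))
        (\<lambda>s'. reg s' ''nodes'' = N \<and> on (filling N) (s'\<lparr>reg := (reg s')(''v'' := N)\<rparr>)) s"
      by (rule runs_mono) (auto simp: filling_def)
  qed simp
  then show ?thesis
  proof (rule runs_mono)
    \<comment> \<open>The additive terms are absorbed by \<open>1 \<le> N * K\<close> and
      \<open>1 \<le> K\<close>, giving 3 + 35 = 38.\<close>
    have "3 + N * (33 * K + 2) \<le> 3 * (N * K) + N * (35 * K)"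
      using K num_nodes_pos[of T] by (intro add_mono mult_left_mono) simp_all
    also have "\<dots> = 38 * (n * N ^ 2)" by (simp add: K_def power2_eq_square)
    finally show "3 + N * (33 * K + 2) \<le> 38 * (n * N ^ 2)" .
  qed (use ex_reached in \<open>auto simp: filling_def\<close>)
qed

section \<open>Comparison of conflict sets\<close>

definition searching :: "'c state \<Rightarrow> bool" where
  "searching s \<longleftrightarrow> on inputs s \<and> table N (nat_arrays s) \<and> reg s ''prediction'' = predict T e"

lemma searching_keeps:
  assumes "searching s" "keeps rs s s'" "rs \<inter> {''features'', ''nodes'', ''query'', ''prediction''} = {}"
  shows "searching s'"
  using assms by (auto simp: searching_def keeps_def inputs_def Let_def)

lemma searching_reg:
  assumes "searching s"
  shows "reg s ''features'' = n" "reg s ''nodes'' = N" "reg s ''query'' = index_of fs x"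
  using inputs_reg assms unfolding searching_def by blast+

lemma searching_conflict:
  "searching s \<Longrightarrow> a < N \<Longrightarrow> j < n \<Longrightarrow> nat_arrays s ''conflict'' (a * n + j) = of_bool (conflict a (fs ! j))"
  by (auto simp: searching_def table_def)

lemma searching_adverse:
  assumes "searching s" "reg s r = a" "a < N"
  shows "tval (is_adverse r) s \<longleftrightarrow> adverse a"
  using assms inputs_node(2)[of _ _ _ _ a] by (auto simp: searching_def table_def adverse_def)

text \<open>Such a \<open>y\<close> shows that the conflict set of \<open>b\<close> is not contained
  in that of \<open>a\<close> without \<open>x\<close>.\<close>

definition separates :: "nat \<Rightarrow> nat \<Rightarrow> 'f \<Rightarrow> bool" where
  "separates a b y \<longleftrightarrow> conflict b y \<and> (\<not> conflict a y \<or> y = x)"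

lemma runs_compare_rows:
  assumes s: "searching s" and row: "reg s ''row'' = b * n" "reg s ''row0'' = a * n" and ab: "a < N" "b < N"
  shows "runs compare_rows (7 * n) (\<lambda>s'. keeps {''y'', ''outside''} s s' \<and>
    reg s' ''outside'' = of_bool (\<exists>y\<in>X. separates a b y)) s"
proof -
  let ?I = "\<lambda>j (s' :: 'c state). keeps {''y'', ''outside''} s s' \<and>
    reg s' ''outside'' = of_bool (\<exists>i<j. separates a b (fs ! i))"
  have "runs compare_rows (3 + n * 4) (\<lambda>s'. reg s' ''features'' = n \<and> ?I n s') s"
    unfolding compare_rows_def
  proof (rule runs_Seq)
    show "runs (Assign ''outside'' (Const 0)) 1
        (\<lambda>s'. keeps {''y'', ''outside''} s s' \<and> reg s' ''outside'' = 0) s"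
      by (intro runs_straight) simp_all
    fix s1 :: "'c state" assume s1: "keeps {''y'', ''outside''} s s1 \<and> reg s1 ''outside'' = 0"
    show "runs (For ''y'' ''features''
       (Cond (Conj (Is (Elem ''conflict'' (Plus (Var ''row'') (Var ''y''))) 1)
                   (Or (Is (Elem ''conflict'' (Plus (Var ''row0'') (Var ''y''))) 0)
                       (Equal (Var ''y'') (Var ''query''))))
          (Assign ''outside'' (Const 1)) Skip)) (2 + n * 4) (\<lambda>s'. reg s' ''features'' = n \<and> ?I n s') s1"
    proof (rule runs_For[where c = 2 and I = ?I])
      have "searching s1" using searching_keeps[OF s] s1 by blast
      then show "reg s1 ''features'' = n" by (rule searching_reg)
      show "?I 0 (s1\<lparr>reg := (reg s1)(''y'' := 0)\<rparr>)" using s1 by simp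
      fix j and s2 :: "'c state"
      assume j: "j < n" "reg s2 ''y'' = j" "reg s2 ''features'' = n" and I: "?I j s2"
      have s2: "searching s2" using searching_keeps[OF s] I by blast
      have regs: "reg s2 ''row'' = b * n" "reg s2 ''row0'' = a * n" "reg s2 ''query'' = index_of fs x"
        using I row searching_reg[OF s2] by (simp_all add: keeps_def)
      have q: "j = index_of fs x \<longleftrightarrow> fs ! j = x"
        using index_of(2)[OF x_mem] index_of_eq[OF j(1)] by auto
      show "runs (Cond (Conj (Is (Elem ''conflict'' (Plus (Var ''row'') (Var ''y''))) 1)
                   (Or (Is (Elem ''conflict'' (Plus (Var ''row0'') (Var ''y''))) 0)
                       (Equal (Var ''y'') (Var ''query''))))
          (Assign ''outside'' (Const 1)) Skip) 2
        (\<lambda>s'. reg s' ''y'' = j \<and> reg s' ''features'' = n \<and> ?I (Suc j) (s'\<lparr>reg := (reg s')(''y'' := Suc j)\<rparr>)) s2"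
        using I j
        by (intro runs_straight) (auto simp: regs q searching_conflict[OF s2 _ j(1)] ab Ex_less_Suc separates_def)
    qed simp_all
  qed simp
  then show ?thesis
  proof (rule runs_mono)
    \<comment> \<open>The constant 3 is absorbed because \<open>x\<close> makes \<open>n\<close>
      positive.\<close>
    show "3 + n * 4 \<le> 7 * n" using n_pos by linarith
    have "(\<exists>y\<in>X. P y) \<longleftrightarrow> (\<exists>i<n. P (fs ! i))" for P
      using ball_X[of "\<lambda>y. \<not> P y"] by blast
    then show "keeps {''y'', ''outside''} s s' \<and> reg s' ''outside'' = of_bool (\<exists>y\<in>X. separates a b y)"
      if "reg s' ''features'' = n \<and> ?I n s'" for s' using that by simp
  qed
qed

lemma runs_test_leaf:
  assumes s: "searching s" and row0: "reg s ''row0'' = a * n" and a: "a < N"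
  shows "runs test_leaf (16 * (n * N)) (\<lambda>s'. keeps {''y'', ''outside'', ''row'', ''w'', ''minimal''} s s' \<and>
    reg s' ''minimal'' = of_bool (\<forall>b. adverse b \<longrightarrow> (\<exists>y\<in>X. separates a b y))) s"
proof -
  let ?rs = "{''y'', ''outside'', ''row'', ''w'', ''minimal''}"
  let ?I = "\<lambda>w (s' :: 'c state). keeps ?rs s s' \<and> reg s' ''row'' = w * n \<and>
    reg s' ''minimal'' = of_bool (\<forall>b<w. adverse b \<longrightarrow> (\<exists>y\<in>X. separates a b y))"
  let ?body = "compare_rows ;;
        Cond (Conj (Is (Var ''outside'') 0) (is_adverse ''w''))
          (Assign ''minimal'' (Const 0)) Skip ;;
        Assign ''row'' (Plus (Var ''row'') (Var ''features''))"
  have "runs test_leaf (4 + N * (7 * n + 3 + 2)) (\<lambda>s'. reg s' ''nodes'' = N \<and> ?I N s') s"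
    unfolding test_leaf_def
  proof (rule runs_Seq)
    show "runs (Assign ''minimal'' (Const 1)) 1 (\<lambda>s'. keeps ?rs s s' \<and> reg s' ''minimal'' = 1) s"
      by (intro runs_straight) simp_all
    fix s1 :: "'c state" assume s1: "keeps ?rs s s1 \<and> reg s1 ''minimal'' = 1"
    show "runs (Assign ''row'' (Const 0) ;; For ''w'' ''nodes'' ?body)
        (3 + N * (7 * n + 3 + 2)) (\<lambda>s'. reg s' ''nodes'' = N \<and> ?I N s') s1"
    proof (rule runs_Seq)
      show "runs (Assign ''row'' (Const 0)) 1
          (\<lambda>s'. keeps ?rs s s' \<and> reg s' ''minimal'' = 1 \<and> reg s' ''row'' = 0) s1"
        using s1 by (intro runs_straight) simp_all
      fix s2 :: "'c state" assume s2: "keeps ?rs s s2 \<and> reg s2 ''minimal'' = 1 \<and> reg s2 ''row'' = 0"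
      show "runs (For ''w'' ''nodes'' ?body)
        (2 + N * (7 * n + 3 + 2)) (\<lambda>s'. reg s' ''nodes'' = N \<and> ?I N s') s2"
      proof (rule runs_For[where c = "7 * n + 3" and I = ?I])
        have "searching s2" using searching_keeps[OF s] s2 by blast
        then show "reg s2 ''nodes'' = N" by (rule searching_reg)
        show "?I 0 (s2\<lparr>reg := (reg s2)(''w'' := 0)\<rparr>)" using s2 by simp
        fix w and s3 :: "'c state"
        assume w: "w < N" "reg s3 ''w'' = w" "reg s3 ''nodes'' = N" and I: "?I w s3"
        have s3: "searching s3" using searching_keeps[OF s] I by blast
        have row: "reg s3 ''row'' = w * n" "reg s3 ''row0'' = a * n"
          using I row0 by (simp_all add: keeps_def)
        show "runs ?body (7 * n + 3) (\<lambda>s'. reg s' ''w'' = w \<and> reg s' ''nodes'' = N \<and>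
            ?I (Suc w) (s'\<lparr>reg := (reg s')(''w'' := Suc w)\<rparr>)) s3"
        proof (rule runs_Seq[OF runs_compare_rows[OF s3 row a w(1)]])
          fix s4 assume s4: "keeps {''y'', ''outside''} s3 s4 \<and>
            reg s4 ''outside'' = of_bool (\<exists>y\<in>X. separates a w y)"
          have k: "keeps ?rs s s4"
            using I s4 by (intro keeps_trans[of ?rs s s3 "{''y'', ''outside''}" s4 ?rs]) simp_all
          then have s: "searching s4" using searching_keeps[OF s] by blast
          have regs: "reg s4 ''w'' = w" "reg s4 ''nodes'' = N" "reg s4 ''row'' = w * n"
            "reg s4 ''features'' = n"
            "reg s4 ''minimal'' = of_bool (\<forall>b<w. adverse b \<longrightarrow> (\<exists>y\<in>X. separates a b y))"
            using s4 w I searching_reg[OF s] by (simp_all add: keeps_def)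
          have "reg s4 ''outside'' = 0 \<longleftrightarrow> \<not> (\<exists>y\<in>X. separates a w y)" using s4 by simp
          note t = this searching_adverse[OF s regs(1) w(1), unfolded tval.simps nval.simps]
          show "runs (Cond (Conj (Is (Var ''outside'') 0) (is_adverse ''w''))
              (Assign ''minimal'' (Const 0)) Skip ;;
            Assign ''row'' (Plus (Var ''row'') (Var ''features''))) 3
            (\<lambda>s'. reg s' ''w'' = w \<and> reg s' ''nodes'' = N \<and>
              ?I (Suc w) (s'\<lparr>reg := (reg s')(''w'' := Suc w)\<rparr>)) s4"
            using k t by (intro runs_straight) (auto simp: regs All_less_Suc)
        qed simp
      qed simp_all
    qed simp
  qed simp
  then show ?thesis
  proof (rule runs_mono)
    \<comment> \<open>A round costs 7 n + 5, at most 12 n; with the additive 4 this gives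
      16.\<close>
    have "4 + N * (7 * n + 3 + 2) \<le> 4 * (N * n) + N * (12 * n)"
      using n_pos num_nodes_pos[of T] by (intro add_mono mult_left_mono) (simp_all add: Suc_le_eq)
    also have "\<dots> = 16 * (n * N)" by simp
    finally show "4 + N * (7 * n + 3 + 2) \<le> 16 * (n * N)" .
    show "keeps ?rs s s' \<and> reg s' ''minimal'' = of_bool (\<forall>b. adverse b \<longrightarrow> (\<exists>y\<in>X. separates a b y))"
      if "reg s' ''nodes'' = N \<and> ?I N s'" for s'
    proof -
      \<comment> \<open>Adverse nodes have numbers below \<open>N\<close>, so the loop has seen all
        of them.\<close>
      have "(\<forall>b<N. adverse b \<longrightarrow> P b) \<longleftrightarrow> (\<forall>b. adverse b \<longrightarrow> P b)" for P by (auto simp: adverse_def)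
      with that show ?thesis by simp
    qed
  qed
qed

lemma runs_search:
  assumes s: "searching s"
  shows "runs search (25 * (n * N ^ 2))
    (\<lambda>s'. reg s' ''answer'' = (if relevant X D (predict T) e x then 1 else 0)) s"
proof -
  let ?rs = "{''y'', ''outside'', ''row'', ''w'', ''minimal''}"
  let ?rs' = "?rs \<union> {''v'', ''row0'', ''answer''}"
  define K where "K = n * N"
  have K: "1 \<le> K" using n_pos num_nodes_pos[of T] by (simp add: K_def Suc_le_eq)
  \<comment> \<open>The condition on a fixed leaf in
    \<open>relevant_iff_minimal_conflict\<close>.\<close>
  define witness where "witness a \<longleftrightarrow> adverse a \<and> conflict a x \<and>
    (\<forall>b. adverse b \<longrightarrow> (\<exists>y\<in>X. separates a b y))" for a
  let ?I = "\<lambda>v (s' :: 'c state). keeps ?rs' s s' \<and> reg s' ''row0'' = v * n \<and>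
    reg s' ''answer'' = of_bool (\<exists>a<v. witness a)"
  let ?rest = "Cond (Conj (Is (Var ''minimal'') 1)
                (Conj (is_adverse ''v'')
                   (Is (Elem ''conflict'' (Plus (Var ''row0'') (Var ''query''))) 1)))
          (Assign ''answer'' (Const 1)) Skip ;;
        Assign ''row0'' (Plus (Var ''row0'') (Var ''features''))"
  have "runs search (4 + N * (16 * K + 3 + 2)) (\<lambda>s'. reg s' ''nodes'' = N \<and> ?I N s') s"
    unfolding search_def
  proof (rule runs_Seq)
    show "runs (Assign ''answer'' (Const 0)) 1 (\<lambda>s'. keeps ?rs' s s' \<and> reg s' ''answer'' = 0) s"
      by (intro runs_straight) simp_all
    fix s1 :: "'c state" assume s1: "keeps ?rs' s s1 \<and> reg s1 ''answer'' = 0"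
    show "runs (Assign ''row0'' (Const 0) ;; For ''v'' ''nodes'' (test_leaf ;; ?rest))
        (3 + N * (16 * K + 3 + 2)) (\<lambda>s'. reg s' ''nodes'' = N \<and> ?I N s') s1"
    proof (rule runs_Seq)
      show "runs (Assign ''row0'' (Const 0)) 1
          (\<lambda>s'. keeps ?rs' s s' \<and> reg s' ''answer'' = 0 \<and> reg s' ''row0'' = 0) s1"
        using s1 by (intro runs_straight) simp_all
      fix s2 :: "'c state" assume s2: "keeps ?rs' s s2 \<and> reg s2 ''answer'' = 0 \<and> reg s2 ''row0'' = 0"
      show "runs (For ''v'' ''nodes'' (test_leaf ;; ?rest))
        (2 + N * (16 * K + 3 + 2)) (\<lambda>s'. reg s' ''nodes'' = N \<and> ?I N s') s2"
      proof (rule runs_For[where c = "16 * K + 3" and I = ?I])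
        have "searching s2" using searching_keeps[OF s, of ?rs' s2] s2 by simp
        then show "reg s2 ''nodes'' = N" by (rule searching_reg)
        show "?I 0 (s2\<lparr>reg := (reg s2)(''v'' := 0)\<rparr>)" using s2 by simp
        fix v and s3 :: "'c state"
        assume v: "v < N" "reg s3 ''v'' = v" "reg s3 ''nodes'' = N" and I: "?I v s3"
        have s3: "searching s3" using searching_keeps[OF s, of ?rs' s3] I by simp
        have row0: "reg s3 ''row0'' = v * n" using I by blast
        show "runs (test_leaf ;; ?rest) (16 * K + 3) (\<lambda>s'. reg s' ''v'' = v \<and> reg s' ''nodes'' = N \<and>
            ?I (Suc v) (s'\<lparr>reg := (reg s')(''v'' := Suc v)\<rparr>)) s3"
        proof (rule runs_Seq[OF runs_test_leaf[OF s3 row0 v(1)]])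
          fix s4 assume s4: "keeps ?rs s3 s4 \<and>
            reg s4 ''minimal'' = of_bool (\<forall>b. adverse b \<longrightarrow> (\<exists>y\<in>X. separates v b y))"
          have k: "keeps ?rs' s s4"
            using I s4 by (intro keeps_trans[of ?rs' s s3 ?rs s4 ?rs']) simp_all
          then have s: "searching s4" using searching_keeps[OF s, of ?rs' s4] by simp
          have regs: "reg s4 ''v'' = v" "reg s4 ''nodes'' = N" "reg s4 ''row0'' = v * n"
            "reg s4 ''features'' = n" "reg s4 ''query'' = index_of fs x"
            "reg s4 ''answer'' = of_bool (\<exists>a<v. witness a)"
            using s4 v I searching_reg[OF s] by (simp_all add: keeps_def)
          have m: "reg s4 ''minimal'' = 1 \<longleftrightarrow> (\<forall>b. adverse b \<longrightarrow> (\<exists>y\<in>X. separates v b y))"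
            using s4 by simp
          have c: "nat_arrays s4 ''conflict'' (v * n + index_of fs x) = of_bool (conflict v x)"
            using searching_conflict[OF s v(1) index_of(1)[OF x_mem]] index_of(2)[OF x_mem] by simp
          have t: "tval (Conj (Is (Var ''minimal'') 1) (Conj (is_adverse ''v'')
              (Is (Elem ''conflict'' (Plus (Var ''row0'') (Var ''query''))) 1))) s4 \<longleftrightarrow> witness v"
            using m c searching_adverse[OF s regs(1) v(1)] regs(3,5) by (auto simp: witness_def)
          show "runs ?rest 3 (\<lambda>s'. reg s' ''v'' = v \<and> reg s' ''nodes'' = N \<and>
              ?I (Suc v) (s'\<lparr>reg := (reg s')(''v'' := Suc v)\<rparr>)) s4"
            using k by (intro runs_straight) (auto simp: t regs Ex_less_Suc simp del: tval.simps One_nat_def)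
        qed (simp add: K_def)
      qed simp_all
    qed simp
  qed simp
  then show ?thesis
  proof (rule runs_mono)
    \<comment> \<open>As before, 16 + 5 = 21 per round, and 4 more for the additive part.\<close>
    have "4 + N * (16 * K + 3 + 2) \<le> 4 * (N * K) + N * (21 * K)"
      using K num_nodes_pos[of T] by (intro add_mono mult_left_mono) (simp_all add: Suc_le_eq)
    also have "\<dots> = 25 * (n * N ^ 2)" by (simp add: K_def power2_eq_square)
    finally show "4 + N * (16 * K + 3 + 2) \<le> 25 * (n * N ^ 2)" .
    have "relevant X D (predict T) e x \<longleftrightarrow> (\<exists>a<N. witness a)"
      unfolding relevant_iff_minimal_conflict witness_def separates_def by (auto simp: adverse_def)
    then show "reg s' ''answer'' = (if relevant X D (predict T) e x then 1 else 0)"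
      if "reg s' ''nodes'' = N \<and> ?I N s'" for s' using that by simp
  qed
qed

text \<open>The factor is the sum of those of the two phases, 38 + 25 = 63.\<close>

lemma runs_program:
  "runs (build_table ;; search) (63 * (n * N ^ 2))
    (\<lambda>s'. reg s' ''answer'' = (if relevant X D (predict T) e x then 1 else 0))
    (input_state fs D k T e x)"
  by (rule runs_Seq[OF runs_build_table[OF inputs_initial[OF refl]] runs_search])
    (simp_all add: searching_def)

end

theorem theorem15:
  shows "\<exists>p C. \<forall>(X :: 'f set) (fs :: 'f list) (D :: 'f \<Rightarrow> 'c feature_domain) (k :: nat)
      (T :: ('f, 'c) dtree) (e :: ('f, 'c) entity) (x :: 'f).
    feature_space X D \<and> distinct fs \<and> set fs = X \<and> decision_tree X D k T \<and>
    e \<in> entities X D \<and> x \<in> X \<longrightarrow>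
    (\<exists>t s. exec p (input_state fs D k T e x) t s \<and>
       t \<le> C * (card X * num_nodes T ^ 2) \<and>
       reg s ''answer'' = (if relevant X D (predict T) e x then 1 else 0))"
proof (rule exI[of _ "build_table ;; search"], rule exI[of _ 63], intro allI impI, elim conjE)
  fix X :: "'f set" and fs and D :: "'f \<Rightarrow> 'c feature_domain" and k T e x
  assume "feature_space X D" "distinct fs" "set fs = X" "decision_tree X D k T"
    "e \<in> entities X D" "x \<in> X"
  then interpret encoded_instance X D k T e x fs
    by unfold_locales
  have "card X = length fs"
    using distinct_fs set_fs distinct_card by metis
  then show "\<exists>t s. exec (build_table ;; search) (input_state fs D k T e x) t s \<and>
       t \<le> 63 * (card X * num_nodes T ^ 2) \<and>
       reg s ''answer'' = (if relevant X D (predict T) e x then 1 else 0)"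
    using runs_program by (simp add: runs_def)
qed

end
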